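(* Let $h>0$ and let $m,p,q,d\in\mathbb{R}$ with $-p\ge q\ge 0$. Let $\gamma$ be the only real (and non-positive) solution of the equation $$\gamma-p=q e^{-h\gamma}.$$ Let $u_0\in C([-h,0];L^1(\mathbb{R}))$ and let $u(t,x)$ be the solution of $$u_t(t,x)=u_{xx}(t,x)+m u_x(t,x)+p u(t,x)+q u(t-h,x+d),\qquad x\in\mathbb{R},\ t>0,$$ with initial datum $u(s,\cdot)=u_0(s,\cdot)$, $s\in[-h,0]$. Then $$\sup_{x\in\mathbb{R}}|u(t,x)|\le A_0\,\frac{e^{\gamma t}}{\sqrt t}\qquad\text{for all } t>\frac h2,$$ where $A_0=\tfrac12\, C_{u_0}\sqrt{1+h(\gamma-p)}$ and $C_{u_0}=\sup_{s\in[-h,0]}\|u_0(s,\cdot)\|_{L^1(\mathbb{R})}$.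
   Context: The solution of the linear delayed Cauchy problem with initial datum $u_0\in C([-h,0];L^1(\mathbb{R}))$ is the usual (mild) solution $u\in C([-h,\infty);L^1(\mathbb{R}))$, i.e. $u(s,\cdot)=u_0(s,\cdot)$ on $[-h,0]$ and for $t>0$ it is given by the variation-of-constants formula with the semigroup generated by $\partial_{xx}+m\partial_x+p$ and source term $q u(t-h,\cdot+d)$. *)

theory Defs
  imports "HOL-Probability.Distributions"
begin

text \<open>
  Elements of \<open>L\<^sup>1(\<real>)\<close> are represented by integrable functions on the real line; the
  classes are recovered by reading all equalities almost everywhere.
\<close>

definition L1_norm :: "(real \<Rightarrow> real) \<Rightarrow> real" where
  "L1_norm f = (LINT x|lborel. \<bar>f x\<bar>)"

definition L1_continuous_on :: "real set \<Rightarrow> (real \<Rightarrow> real \<Rightarrow> real) \<Rightarrow> bool" where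
  "L1_continuous_on I w \<longleftrightarrow>
     (\<forall>t\<in>I. integrable lborel (w t)) \<and>
     (\<forall>t\<in>I. ((\<lambda>s. L1_norm (\<lambda>x. w s x - w t x)) \<longlongrightarrow> 0) (at t within I))"

text \<open>
  Convolution kernel of the semigroup on \<open>L\<^sup>1(\<real>)\<close> generated by
  \<open>\<partial>\<^sub>x\<^sub>x + m \<partial>\<^sub>x + p\<close>: the heat kernel, that is the centred normal density of
  variance \<open>2 t\<close>, translated by \<open>- m t\<close> and multiplied by \<open>exp (p t)\<close>. The lemmas
  \<open>drift_kernel_pde\<close> and \<open>drift_kernel_mass\<close> below check that it solves the equation without
  the delay term and has mass \<open>exp (p t)\<close>.
\<close>

definition drift_kernel :: "real \<Rightarrow> real \<Rightarrow> real \<Rightarrow> real \<Rightarrow> real" where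
  "drift_kernel m p t z = exp (p * t) * normal_density (- m * t) (sqrt (2 * t)) z"

text \<open>Only used for positive times; at time \<open>0\<close> the formula is not the identity.\<close>

definition drift_semigroup ::
  "real \<Rightarrow> real \<Rightarrow> real \<Rightarrow> (real \<Rightarrow> real) \<Rightarrow> real \<Rightarrow> real" where
  "drift_semigroup m p t f x = (LINT y|lborel. drift_kernel m p t (x - y) * f y)"

text \<open>
  Mild solutions in \<open>C([-h,\<infinity>); L\<^sup>1(\<real>))\<close>. The \<open>L\<^sup>1\<close>-valued integral in the
  variation-of-constants formula is written as a pointwise integral in time, which converges
  absolutely at every \<open>x\<close>. The integrand at the single time \<open>s = t\<close> is irrelevant.
\<close>

definition delay_mild_solution ::
  "real \<Rightarrow> real \<Rightarrow> real \<Rightarrow> real \<Rightarrow> real \<Rightarrow> (real \<Rightarrow> real \<Rightarrow> real) \<Rightarrow> (real \<Rightarrow> real \<Rightarrow> real) \<Rightarrow> bool"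
where
  "delay_mild_solution h m p q d u0 u \<longleftrightarrow>
     L1_continuous_on {-h..} u \<and>
     (\<forall>s\<in>{-h..0}. AE x in lborel. u s x = u0 s x) \<and>
     (\<forall>t>0. AE x in lborel.
        u t x = drift_semigroup m p t (u0 0) x
          + (LINT s:{0..t}|lborel. drift_semigroup m p (t - s) (\<lambda>y. q * u (s - h) (y + d)) x))"

lemma drift_kernel_mass:
  assumes "t > 0"
  shows "integrable lborel (drift_kernel m p t)"
    and "(LINT z|lborel. drift_kernel m p t z) = exp (p * t)"
  using assms integrable_normal_density[of "sqrt (2 * t)" "- m * t"]
    integral_normal_density[of "sqrt (2 * t)" "- m * t"]
  by (simp_all add: drift_kernel_def[abs_def])

lemma drift_kernel_eq:
  assumes "t > 0"
  shows "drift_kernel m p t z =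
    exp (p * t) * exp (- ((z + m * t)\<^sup>2 / (4 * t))) / sqrt (4 * pi * t)"
  using assms by (simp add: drift_kernel_def normal_density_def)

lemma drift_kernel_pde:
  fixes m p t z :: real
  assumes t: "t > 0"
  defines "Kz \<equiv> \<lambda>z. - (z + m * t) / (2 * t) * drift_kernel m p t z"
  defines "Kzz \<equiv> \<lambda>z. ((z + m * t)\<^sup>2 / (4 * t\<^sup>2) - 1 / (2 * t)) * drift_kernel m p t z"
  shows "((\<lambda>z. drift_kernel m p t z) has_real_derivative Kz z) (at z)"
    and "(Kz has_real_derivative Kzz z) (at z)"
    and "((\<lambda>r. drift_kernel m p r z) has_real_derivative
            Kzz z + m * Kz z + p * drift_kernel m p t z) (at t)"
proof -
  define S where "S = sqrt (4 * pi * t)"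
  have S: "S > 0" "S * S = 4 * pi * t"
    using t by (auto simp: S_def)
  have arg: "((\<lambda>z. - ((z + m * t)\<^sup>2 / (4 * t))) has_real_derivative - (z + m * t) / (2 * t)) (at z)" for z
    using t by (auto intro!: derivative_eq_intros simp: divide_simps)
  have 1: "((\<lambda>z. drift_kernel m p t z) has_real_derivative Kz z) (at z)" for z
    unfolding drift_kernel_eq[OF t] Kz_def
    by (rule DERIV_cong, rule DERIV_cdivide, rule DERIV_cmult, rule DERIV_fun_exp, rule arg) simp
  show "((\<lambda>z. drift_kernel m p t z) has_real_derivative Kz z) (at z)" by (rule 1)
  have lin: "((\<lambda>z. - (z + m * t) / (2 * t)) has_real_derivative - 1 / (2 * t)) (at z)"
    using t by (auto intro!: derivative_eq_intros)
  have quad: "- (z + m * t) / (2 * t) * (- (z + m * t) / (2 * t)) = (z + m * t)\<^sup>2 / (4 * t\<^sup>2)"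
    by (simp add: power2_eq_square) (simp add: algebra_simps)
  show "(Kz has_real_derivative Kzz z) (at z)"
  proof -
    have "(Kz has_real_derivative
        - 1 / (2 * t) * drift_kernel m p t z + Kz z * (- (z + m * t) / (2 * t))) (at z)"
      unfolding Kz_def by (rule DERIV_mult[OF lin 1[unfolded Kz_def]])
    also have "- 1 / (2 * t) * drift_kernel m p t z + Kz z * (- (z + m * t) / (2 * t))
        = (- (z + m * t) / (2 * t) * (- (z + m * t) / (2 * t)) - 1 / (2 * t)) * drift_kernel m p t z"
      unfolding Kz_def by algebra
    also have "\<dots> = Kzz z"
      unfolding quad Kzz_def ..
    finally show ?thesis .
  qed
  define E where "E = exp (p * t) * exp (- ((z + m * t)\<^sup>2 / (4 * t)))"
  define e where "e = p - m * (z + m * t) / (2 * t) + (z + m * t)\<^sup>2 / (4 * t\<^sup>2)"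
  have darg: "((\<lambda>r. p * r + - ((z + m * r)\<^sup>2 / (4 * r))) has_real_derivative e) (at t)"
    unfolding e_def using t
    by (auto intro!: derivative_eq_intros simp: field_simps power2_eq_square)
  have dE: "((\<lambda>r. exp (p * r) * exp (- ((z + m * r)\<^sup>2 / (4 * r)))) has_real_derivative E * e) (at t)"
    using DERIV_fun_exp[OF darg] unfolding E_def exp_add .
  have dS: "((\<lambda>r. sqrt (4 * pi * r)) has_real_derivative S / (2 * t)) (at t)"
  proof -
    have "((\<lambda>r. sqrt (4 * pi * r)) has_real_derivative inverse S / 2 * (4 * pi)) (at t)"
      unfolding S_def using t
      by (auto intro!: derivative_eq_intros simp: zero_less_mult_iff mult_less_0_iff)
    moreover have "inverse S / 2 * (4 * pi) = S / (2 * t)"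
      using S t by (simp add: field_simps)
    ultimately show ?thesis by simp
  qed
  have "((\<lambda>r. drift_kernel m p r z) has_real_derivative
          (E * e * S - E * (S / (2 * t))) / (S * S)) (at t)"
  proof (rule has_field_derivative_transform_within_open)
    show "((\<lambda>r. exp (p * r) * exp (- ((z + m * r)\<^sup>2 / (4 * r))) / sqrt (4 * pi * r))
        has_real_derivative (E * e * S - E * (S / (2 * t))) / (S * S)) (at t)"
      using DERIV_divide[OF dE dS] S t by (simp add: E_def S_def)
    show "exp (p * r) * exp (- ((z + m * r)\<^sup>2 / (4 * r))) / sqrt (4 * pi * r) = drift_kernel m p r z"
      if "r \<in> {0<..}" for r
      using that by (simp add: drift_kernel_eq)
  qed (use t in auto)
  also have "(E * e * S - E * (S / (2 * t))) / (S * S) = (e - 1 / (2 * t)) * (E / S)"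
  proof -
    have "E * e * S - E * (S / (2 * t)) = (e - 1 / (2 * t)) * E * S"
      by (simp add: algebra_simps)
    then show ?thesis using S(1) by simp
  qed
  also have "\<dots> = Kzz z + m * Kz z + p * drift_kernel m p t z"
  proof -
    have K: "drift_kernel m p t z = E / S"
      by (simp add: drift_kernel_eq[OF t] E_def S_def)
    define w where "w = (z + m * t) / (2 * t)"
    have w: "- (z + m * t) / (2 * t) = - w" "m * (z + m * t) / (2 * t) = m * w"
      unfolding w_def by (simp_all only: minus_divide_left times_divide_eq_right)
    show ?thesis
      unfolding Kz_def Kzz_def K e_def w by (simp add: algebra_simps)
  qed
  finally show "((\<lambda>r. drift_kernel m p r z) has_real_derivative
            Kzz z + m * Kz z + p * drift_kernel m p t z) (at t)" .
qed

end

theory Submission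
  imports Defs "HOL-Probability.Sinc_Integral"
begin

text \<open>
  No Fourier transform of the solution is needed: the Fourier side enters only through
  \<open>1 / sqrt (4 \<pi> r) = 1 / (2 \<pi>) \<integral> exp (- \<xi>\<^sup>2 r) d\<xi>\<close>. Writing \<open>S r\<close> for the drift semigroup, one
  propagates along the variation-of-constants formula the smoothed bounds
  \<open>\<bar>S r (u s) x\<bar> \<le> C / (2 \<pi>) \<integral> exp ((p - \<xi>\<^sup>2) r + \<Lambda> \<xi> * s) d\<xi>\<close> for all \<open>r > 0\<close>. They hold
  on the initial interval if \<open>\<Lambda> \<le> 0\<close>, and they survive a time step if
  \<open>q exp (- \<eta> \<Lambda> \<xi>) \<le> \<Lambda> \<xi> + \<xi>\<^sup>2 - p\<close>, i.e. if \<open>exp (\<Lambda> \<xi> * t)\<close> is a supersolution of the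
  equation of the mode \<open>\<xi>\<close> with delay \<open>\<eta>\<close>. With \<open>\<kappa> = 1 + h (\<gamma> - p)\<close> the choice
  \<open>\<Lambda> \<xi> = \<gamma> - ln (1 + \<eta> \<xi>\<^sup>2 / \<kappa>) / \<eta>\<close> works for every \<open>\<eta> \<le> h\<close>, and Bernoulli's
  inequality gives \<open>exp (\<Lambda> \<xi> * t) \<le> exp (\<gamma> t) / (1 + t \<xi>\<^sup>2 / \<kappa>)\<close> as soon as \<open>\<eta> \<le> t\<close>, whose
  integral over \<open>\<xi>\<close> is \<open>\<pi> exp (\<gamma> t) sqrt (\<kappa> / t)\<close>. So one takes \<open>\<eta> = min h t\<close>: for
  \<open>t < h\<close> only initial data enter the delay term up to time \<open>t\<close>, which allows the smaller
  delay.
\<close>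

section \<open>Kernel and semigroup\<close>

lemma drift_kernel_nonneg: "0 \<le> drift_kernel m p t z"
  by (simp add: drift_kernel_def)

lemma drift_kernel_measurable [measurable]: "drift_kernel m p t \<in> borel_measurable borel"
  unfolding drift_kernel_def[abs_def] by measurable

text \<open>Division by zero is zero, so \<open>normal_density\<close> with standard deviation 0
  vanishes. Hence \<open>drift_semigroup\<close> at time 0 is the zero map and not the identity,
  which fixes the value of the Duhamel integrand at \<open>s = t\<close>.\<close>

lemma drift_kernel_zero [simp]: "drift_kernel m p 0 z = 0"
  by (simp add: drift_kernel_def normal_density_def)

lemma drift_semigroup_zero [simp]: "drift_semigroup m p 0 f x = 0"
  by (simp add: drift_semigroup_def)

lemma drift_kernel_le:
  assumes "t > 0"
  shows "drift_kernel m p t z \<le> exp (p * t) / sqrt (4 * pi * t)"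
  unfolding drift_kernel_eq[OF assms] using assms
  by (intro divide_right_mono) (auto simp: mult_le_cancel_left1)

lemma continuous_on_drift_kernel:
  "continuous_on ({0<..} \<times> UNIV) (\<lambda>(t, z). drift_kernel m p t z)"
proof -
  have "continuous_on ({0<..} \<times> UNIV) (\<lambda>(t, z).
      exp (p * t) * exp (- ((z + m * t)\<^sup>2 / (4 * t))) / sqrt (4 * pi * t))"
    by (auto simp: case_prod_beta intro!: continuous_intros)
  then show ?thesis
    by (rule continuous_on_cong[THEN iffD1, rotated 2]) (auto simp: drift_kernel_eq)
qed

lemma LIMSEQ_drift_kernel:
  assumes "r \<longlonglongrightarrow> t" "y \<longlonglongrightarrow> z" "t > 0" "\<And>n. r n > 0"
  shows "(\<lambda>n. drift_kernel m p (r n) (y n)) \<longlonglongrightarrow> drift_kernel m p t z"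
  using continuous_on_tendsto_compose[OF continuous_on_drift_kernel tendsto_Pair[OF assms(1,2)]] assms
  by (auto simp: case_prod_beta)

section \<open>Convolution with the kernel: integrability and smoothing from L1 to bounded
  functions\<close>

lemma integrable_bounded_mult:
  fixes f k :: "real \<Rightarrow> real"
  assumes "integrable lborel f" "k \<in> borel_measurable borel" "\<And>y. \<bar>k y\<bar> \<le> b"
  shows "integrable lborel (\<lambda>y. k y * f y)"
proof (rule Bochner_Integration.integrable_bound)
  show "integrable lborel (\<lambda>y. b * \<bar>f y\<bar>)" using assms(1) by simp
  show "(\<lambda>y. k y * f y) \<in> borel_measurable lborel" using assms(1,2) by measurable
  show "AE y in lborel. norm (k y * f y) \<le> norm (b * \<bar>f y\<bar>)"
    using assms(3) by (auto simp: abs_mult intro!: mult_right_mono order_trans[OF assms(3)])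
qed

lemma integrable_drift_kernel_mult:
  assumes "t > 0" "integrable lborel f"
  shows "integrable lborel (\<lambda>y. drift_kernel m p t (x - y) * f y)"
proof (rule integrable_bounded_mult[OF assms(2)])
  show "\<bar>drift_kernel m p t (x - y)\<bar> \<le> exp (p * t) / sqrt (4 * pi * t)" for y
    using drift_kernel_le[OF assms(1), of m p "x - y"] drift_kernel_nonneg[of m p t "x - y"] by simp
qed measurable

lemma L1_norm_nonneg: "0 \<le> L1_norm f"
  by (simp add: L1_norm_def)

lemma drift_semigroup_le:
  assumes "t > 0" "integrable lborel f"
  shows "\<bar>drift_semigroup m p t f x\<bar> \<le> exp (p * t) / sqrt (4 * pi * t) * L1_norm f"
proof -
  have "\<bar>drift_semigroup m p t f x\<bar> \<le> (LINT y|lborel. \<bar>drift_kernel m p t (x - y) * f y\<bar>)"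
    unfolding drift_semigroup_def by (rule integral_abs_bound)
  also have "\<dots> \<le> (LINT y|lborel. exp (p * t) / sqrt (4 * pi * t) * \<bar>f y\<bar>)"
  proof (intro integral_mono integrable_abs integrable_drift_kernel_mult assms)
    show "\<bar>drift_kernel m p t (x - y) * f y\<bar> \<le> exp (p * t) / sqrt (4 * pi * t) * \<bar>f y\<bar>" for y
      unfolding abs_mult abs_of_nonneg[OF drift_kernel_nonneg]
      by (intro mult_right_mono drift_kernel_le assms) simp
  qed (use assms in simp)
  finally show ?thesis by (simp add: L1_norm_def)
qed

lemma drift_semigroup_diff:
  assumes "t > 0" "integrable lborel f" "integrable lborel g"
  shows "drift_semigroup m p t (\<lambda>y. f y - g y) x = drift_semigroup m p t f x - drift_semigroup m p t g x"
  using assms unfolding drift_semigroup_def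
  by (simp add: right_diff_distrib integrable_drift_kernel_mult)

text \<open>After smoothing, the choice of representative no longer matters: this lets the initial
  datum or the mild formula replace \<open>u t\<close> at every point.\<close>

lemma drift_semigroup_cong_AE:
  assumes "AE y in lborel. f y = g y" "f \<in> borel_measurable borel" "g \<in> borel_measurable borel"
  shows "drift_semigroup m p t f x = drift_semigroup m p t g x"
  unfolding drift_semigroup_def using assms by (intro integral_cong_AE) auto

text \<open>Convolution commutes with translations, so the shift \<open>d\<close> only moves the
  evaluation point and is invisible to bounds that hold for all \<open>x\<close>.\<close>

lemma drift_semigroup_cmult_shift:
  "drift_semigroup m p t (\<lambda>y. q * f (y + d)) x = q * drift_semigroup m p t f (x + d)"
  unfolding drift_semigroup_def
  using lborel_integral_real_affine[of 1 "\<lambda>y. drift_kernel m p t (x + d - y) * f y" d]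
  by (simp add: algebra_simps)

text \<open>Dominated convergence: the times converge to a positive limit, so the suprema of the
  kernels stay below some \<open>B\<close>, and \<open>B * \<bar>f z\<bar>\<close> is a
  majorant.\<close>

lemma LIMSEQ_drift_semigroup:
  assumes f: "integrable lborel f" and r: "r \<longlonglongrightarrow> t" and y: "y \<longlonglongrightarrow> x" and t: "t > 0" and rn: "\<And>n. r n > 0"
  shows "(\<lambda>n. drift_semigroup m p (r n) f (y n)) \<longlonglongrightarrow> drift_semigroup m p t f x"
proof -
  define c where "c = (\<lambda>n. exp (p * r n) / sqrt (4 * pi * r n))"
  have "c \<longlonglongrightarrow> exp (p * t) / sqrt (4 * pi * t)"
    unfolding c_def using t by (auto intro!: tendsto_intros r)
  then obtain B where B: "\<And>n. \<bar>c n\<bar> \<le> B"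
    using convergent_imp_Bseq[of c] unfolding convergent_def Bseq_def by auto
  have "drift_kernel m p (r n) z \<le> B" for n z
    using drift_kernel_le[OF rn, of m p n z] B[of n] unfolding c_def by linarith
  then have le: "\<bar>drift_kernel m p (r n) z\<bar> \<le> B" for n z
    by (simp add: drift_kernel_nonneg)
  show ?thesis unfolding drift_semigroup_def
  proof (rule integral_dominated_convergence[where w = "\<lambda>z. B * \<bar>f z\<bar>"])
    show "AE z in lborel. (\<lambda>n. drift_kernel m p (r n) (y n - z) * f z) \<longlonglongrightarrow> drift_kernel m p t (x - z) * f z"
      by (intro AE_I2 tendsto_intros LIMSEQ_drift_kernel r y t rn)
    show "AE z in lborel. norm (drift_kernel m p (r n) (y n - z) * f z) \<le> B * \<bar>f z\<bar>" for n
      by (intro AE_I2) (auto simp: abs_mult intro!: mult_right_mono le)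
  qed (use f in auto)
qed

text \<open>Split \<open>w (s n)\<close> into \<open>w (s n) - w s'\<close> and \<open>w s'\<close>.
  The smoothing estimate sends the first part to zero uniformly in \<open>x\<close>; the second is a
  fixed function.\<close>

lemma LIMSEQ_drift_semigroup_L1:
  assumes w: "L1_continuous_on I w" and s: "s \<longlonglongrightarrow> s'" "s' \<in> I" "\<And>n. s n \<in> I"
    and r: "r \<longlonglongrightarrow> t" and y: "y \<longlonglongrightarrow> x" and t: "t > 0" and rn: "\<And>n. r n > 0"
  shows "(\<lambda>n. drift_semigroup m p (r n) (w (s n)) (y n)) \<longlonglongrightarrow> drift_semigroup m p t (w s') x"
proof -
  have int: "integrable lborel (w a)" if "a \<in> I" for a
    using w that by (auto simp: L1_continuous_on_def)
  have "((\<lambda>a. L1_norm (\<lambda>x. w a x - w s' x)) \<longlongrightarrow> 0) (at s' within I)"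
    using w s(2) by (auto simp: L1_continuous_on_def)
  \<comment> \<open>The norm at \<open>a = s'\<close> is 0, so the punctured limit is continuity,
    and the sequence may hit \<open>s'\<close>.\<close>
  then have "continuous (at s' within I) (\<lambda>a. L1_norm (\<lambda>x. w a x - w s' x))"
    by (simp add: continuous_within L1_norm_def)
  then have L: "(\<lambda>n. L1_norm (\<lambda>x. w (s n) x - w s' x)) \<longlonglongrightarrow> 0"
    using continuous_within_tendsto_compose'[of s' I "\<lambda>a. L1_norm (\<lambda>x. w a x - w s' x)" s sequentially] s
    by (simp add: L1_norm_def)
  have "(\<lambda>n. exp (p * r n) / sqrt (4 * pi * r n) * L1_norm (\<lambda>x. w (s n) x - w s' x))
      \<longlonglongrightarrow> exp (p * t) / sqrt (4 * pi * t) * 0"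
    by (intro tendsto_intros r L) (use t in auto)
  then have "(\<lambda>n. exp (p * r n) / sqrt (4 * pi * r n) * L1_norm (\<lambda>x. w (s n) x - w s' x)) \<longlonglongrightarrow> 0"
    by simp
  then have "(\<lambda>n. drift_semigroup m p (r n) (\<lambda>x. w (s n) x - w s' x) (y n)) \<longlonglongrightarrow> 0"
  proof (rule Lim_null_comparison[rotated], intro always_eventually allI)
    show "norm (drift_semigroup m p (r n) (\<lambda>x. w (s n) x - w s' x) (y n))
        \<le> exp (p * r n) / sqrt (4 * pi * r n) * L1_norm (\<lambda>x. w (s n) x - w s' x)" for n
      unfolding real_norm_def by (intro drift_semigroup_le rn Bochner_Integration.integrable_diff int s)
  qed
  from tendsto_add[OF this LIMSEQ_drift_semigroup[where m = m and p = p, OF int[OF s(2)] r y t rn]]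
  show ?thesis
    by (simp add: drift_semigroup_diff rn int s)
qed

lemma drift_semigroup_measurable [measurable]:
  assumes "t > 0" "integrable lborel f"
  shows "drift_semigroup m p t f \<in> borel_measurable borel"
proof (intro borel_measurable_continuous_onI)
  show "continuous_on UNIV (drift_semigroup m p t f)"
    unfolding continuous_on_sequentially comp_def
    by (auto intro!: LIMSEQ_drift_semigroup assms)
qed

text \<open>Chapman-Kolmogorov identity. Translating \<open>y\<close> by \<open>m * s\<close>
  removes the drift and leaves the convolution of two centred Gaussians, whose variances
  add.\<close>

lemma drift_kernel_convolution:
  assumes "r > 0" "s > 0"
  shows "has_bochner_integral lborel (\<lambda>y. drift_kernel m p r (x - y) * drift_kernel m p s y)
           (drift_kernel m p (r + s) x)"
proof (rule has_bochner_integral_nn_integral)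
  have shift: "normal_density (- (m * t)) \<sigma> z = normal_density 0 \<sigma> (z + m * t)" for t \<sigma> z
    by (simp add: normal_density_def)
  let ?g = "\<lambda>y. ennreal (normal_density 0 (sqrt (2 * r)) (x + m * (r + s) - y) * normal_density 0 (sqrt (2 * s)) y)"
  have "(\<integral>\<^sup>+y. ennreal (drift_kernel m p r (x - y) * drift_kernel m p s y) \<partial>lborel)
    = (\<integral>\<^sup>+y. ennreal (exp (p * (r + s))) * ?g (m * s + 1 * y) \<partial>lborel)"
    by (intro nn_integral_cong)
       (simp add: drift_kernel_def shift ennreal_mult[symmetric] exp_add algebra_simps)
  also have "\<dots> = ennreal (exp (p * (r + s))) * (\<integral>\<^sup>+y. ?g (m * s + 1 * y) \<partial>lborel)"
    by (intro nn_integral_cmult) auto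
  also have "(\<integral>\<^sup>+y. ?g (m * s + 1 * y) \<partial>lborel) = (\<integral>\<^sup>+y. ?g y \<partial>lborel)"
    by (subst nn_integral_real_affine[of ?g 1 "m * s"]) auto
  also have "\<dots> = ennreal (normal_density 0 (sqrt (2 * (r + s))) (x + m * (r + s)))"
    using fun_cong[OF conv_normal_density_zero_mean[of "sqrt (2 * r)" "sqrt (2 * s)"], of "x + m * (r + s)"] assms
    by (simp add: distrib_left)
  finally show "(\<integral>\<^sup>+y. ennreal (drift_kernel m p r (x - y) * drift_kernel m p s y) \<partial>lborel)
      = ennreal (drift_kernel m p (r + s) x)"
    by (simp add: drift_kernel_def shift ennreal_mult)
qed (auto simp: drift_kernel_nonneg)

text \<open>Fubini and the kernel identity; absolute integrability holds because the inner integral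
  of the modulus is the kernel at time \<open>r + s\<close> times
  \<open>\<bar>f z\<bar>\<close>.\<close>

lemma drift_semigroup_semigroup:
  assumes r: "r > 0" and s: "s > 0" and f: "integrable lborel f"
  shows "drift_semigroup m p r (drift_semigroup m p s f) x = drift_semigroup m p (r + s) f x"
proof -
  let ?F = "\<lambda>(z, y). drift_kernel m p r (x - y) * drift_kernel m p s (y - z) * f z"
  have [measurable]: "f \<in> borel_measurable borel" using f by simp
  have conv: "has_bochner_integral lborel (\<lambda>y. drift_kernel m p r (x - y) * drift_kernel m p s (y - z))
      (drift_kernel m p (r + s) (x - z))" for z
  proof -
    have "has_bochner_integral lborel
        (\<lambda>y. drift_kernel m p r (x - z - (- z + 1 * y)) * drift_kernel m p s (- z + 1 * y))
        (drift_kernel m p (r + s) (x - z) /\<^sub>R \<bar>1\<bar>)"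
      by (subst lborel_has_bochner_integral_real_affine_iff[symmetric])
         (auto intro: drift_kernel_convolution r s)
    then show ?thesis by simp
  qed
  have F: "integrable (lborel \<Otimes>\<^sub>M lborel) ?F"
  proof (rule lborel_pair.Fubini_integrable)
    show "?F \<in> borel_measurable (lborel \<Otimes>\<^sub>M lborel)" by measurable
    have "(\<integral>y. norm (?F (z, y)) \<partial>lborel) = drift_kernel m p (r + s) (x - z) * \<bar>f z\<bar>" for z
      using has_bochner_integral_integral_eq[OF conv]
      by (simp add: abs_mult drift_kernel_nonneg)
    then show "integrable lborel (\<lambda>z. \<integral>y. norm (?F (z, y)) \<partial>lborel)"
      using integrable_drift_kernel_mult[of "r + s" "\<lambda>z. \<bar>f z\<bar>"] r s f by simp
    show "AE z in lborel. integrable lborel (\<lambda>y. ?F (z, y))"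
      using conv by (auto simp: has_bochner_integral_iff)
  qed
  have "drift_semigroup m p r (drift_semigroup m p s f) x = (\<integral>y. \<integral>z. ?F (z, y) \<partial>lborel \<partial>lborel)"
    unfolding drift_semigroup_def by (simp add: mult.assoc)
  also have "\<dots> = (\<integral>z. \<integral>y. ?F (z, y) \<partial>lborel \<partial>lborel)"
    using lborel_pair.Fubini_integral[OF F] by simp
  also have "\<dots> = drift_semigroup m p (r + s) f x"
    unfolding drift_semigroup_def using has_bochner_integral_integral_eq[OF conv] by simp
  finally show ?thesis .
qed

section \<open>The Duhamel term\<close>

lemma ennreal_abs_add_le: "ennreal \<bar>a + b\<bar> \<le> ennreal \<bar>a\<bar> + ennreal \<bar>b\<bar>"
  by (metis abs_ge_zero abs_triangle_ineq ennreal_leI ennreal_plus)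

lemma abs_integral_le_nn_integral:
  fixes f :: "'a \<Rightarrow> real"
  shows "ennreal \<bar>integral\<^sup>L M f\<bar> \<le> (\<integral>\<^sup>+x. ennreal \<bar>f x\<bar> \<partial>M)"
  by (cases "integrable M f")
     (use integral_norm_bound_ennreal[of M f] in \<open>auto simp: not_integrable_integral_eq\<close>)

lemma integrable_drift_kernel_reflect:
  assumes "t > 0"
  shows "integrable lborel (\<lambda>y. drift_kernel m p t (x - y))"
  using lborel_integrable_real_affine[OF drift_kernel_mass(1)[OF assms], where c = "-1" and t = x]
  by simp

section \<open>Norms along an L1-continuous family\<close>

lemma L1_norm_triangle:
  assumes "integrable lborel f" "integrable lborel g"
  shows "\<bar>L1_norm f - L1_norm g\<bar> \<le> L1_norm (\<lambda>x. f x - g x)"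
proof -
  have "L1_norm f - L1_norm g = (LINT x|lborel. \<bar>f x\<bar> - \<bar>g x\<bar>)"
    using assms by (simp add: L1_norm_def)
  also have "\<bar>\<dots>\<bar> \<le> (LINT x|lborel. \<bar>\<bar>f x\<bar> - \<bar>g x\<bar>\<bar>)"
    by (rule integral_abs_bound)
  also have "\<dots> \<le> L1_norm (\<lambda>x. f x - g x)"
    unfolding L1_norm_def using assms by (intro integral_mono) auto
  finally show ?thesis .
qed

lemma L1_continuous_on_bounded:
  assumes w: "L1_continuous_on I w" and I: "compact I"
  shows "bdd_above ((\<lambda>s. L1_norm (w s)) ` I)"
proof -
  have "continuous_on I (\<lambda>s. L1_norm (w s))"
    unfolding continuous_on_def
  proof
    fix a assume a: "a \<in> I"
    have "((\<lambda>s. L1_norm (\<lambda>x. w s x - w a x)) \<longlongrightarrow> 0) (at a within I)"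
      using w a by (auto simp: L1_continuous_on_def)
    then have "((\<lambda>s. L1_norm (w s) - L1_norm (w a)) \<longlongrightarrow> 0) (at a within I)"
      by (rule Lim_null_comparison[rotated])
         (use w a in \<open>auto simp: L1_continuous_on_def eventually_at_filter intro!: always_eventually L1_norm_triangle\<close>)
    then show "((\<lambda>s. L1_norm (w s)) \<longlongrightarrow> L1_norm (w a)) (at a within I)"
      by (simp add: LIM_zero_iff)
  qed
  then show ?thesis
    by (intro bounded_imp_bdd_above compact_imp_bounded compact_continuous_image I)
qed

definition duhamel :: "real \<Rightarrow> real \<Rightarrow> (real \<Rightarrow> real \<Rightarrow> real) \<Rightarrow> real \<Rightarrow> real \<Rightarrow> real" where
  "duhamel m p w t x = (LINT s:{0..t}|lborel. drift_semigroup m p (t - s) (w s) x)"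

text \<open>The smoothing estimate blows up like this function as \<open>s\<close> approaches
  \<open>t\<close>; its integrability supplies the majorant for the Duhamel integrals. It is
  \<open>x powr (-1/2)\<close> reflected by \<open>x = t - s\<close>; at \<open>x = 0\<close> both
  expressions are 0.\<close>

lemma integrable_inverse_sqrt:
  assumes "t > 0"
  shows "integrable lborel (\<lambda>s. indicator {0..t} s * (1 / sqrt (t - s)))"
proof -
  have "(\<lambda>x. x powr (-1/2)) absolutely_integrable_on {0..t}"
    using assms by (intro nonnegative_absolutely_integrable_1 integrable_on_powr_from_0) auto
  then have "integrable lborel (\<lambda>x. indicator {0..t} x *\<^sub>R (x powr (-1/2)))"
    unfolding set_integrable_def by (subst (asm) integrable_completion) auto
  from lborel_integrable_real_affine[OF this, of "-1" t]
  show ?thesis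
    by (rule back_subst[of "integrable lborel"])
       (use assms in \<open>auto simp: fun_eq_iff powr_minus powr_half_sqrt divide_simps split: split_indicator\<close>)
qed

text \<open>The L1 norms of \<open>w s\<close> are bounded on the compact interval, and the
  smoothing estimate contributes \<open>1 / sqrt (t - s)\<close>. The constant depends on neither
  \<open>s\<close> nor \<open>x\<close>; at \<open>s = t\<close> both sides vanish.\<close>

lemma duhamel_integrand_le:
  assumes w: "L1_continuous_on {0..t} w"
  obtains B where "B \<ge> 0"
    "\<And>s x. \<bar>indicator {0..t} s * drift_semigroup m p (t - s) (w s) x\<bar> \<le> B * (indicator {0..t} s * (1 / sqrt (t - s)))"
proof -
  obtain M where M: "\<And>s. s \<in> {0..t} \<Longrightarrow> L1_norm (w s) \<le> M"
    using L1_continuous_on_bounded[OF w compact_Icc] unfolding bdd_above_def by blast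
  define B where "B = exp (\<bar>p\<bar> * t) * max M 0"
  have "\<bar>drift_semigroup m p (t - s) (w s) x\<bar> \<le> B * (1 / sqrt (t - s))" if s: "s \<in> {0..<t}" for s x
  proof -
    have "\<bar>drift_semigroup m p (t - s) (w s) x\<bar> \<le> exp (p * (t - s)) / sqrt (4 * pi * (t - s)) * L1_norm (w s)"
      using s w by (intro drift_semigroup_le) (auto simp: L1_continuous_on_def)
    also have "\<dots> \<le> exp (\<bar>p\<bar> * t) / sqrt (t - s) * max M 0"
    proof (intro mult_mono frac_le)
      show "exp (p * (t - s)) \<le> exp (\<bar>p\<bar> * t)"
        using s by (simp add: mult_mono)
      have "1 * (t - s) \<le> (4 * pi) * (t - s)"
        using s pi_ge_two by (intro mult_right_mono) auto
      then show "sqrt (t - s) \<le> sqrt (4 * pi * (t - s))"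
        by (intro real_sqrt_le_mono) simp
      show "L1_norm (w s) \<le> max M 0" using M[of s] s by auto
    qed (use s L1_norm_nonneg in auto)
    finally show ?thesis by (simp add: B_def)
  qed
  moreover have "drift_semigroup m p (t - s) (w s) x = 0" if "s = t" for s x
    using that by simp
  ultimately have "\<bar>indicator {0..t} s * drift_semigroup m p (t - s) (w s) x\<bar> \<le> B * (indicator {0..t} s * (1 / sqrt (t - s)))" for s x
    by (cases "s = t") (auto split: split_indicator)
  moreover have "B \<ge> 0" by (simp add: B_def)
  ultimately show ?thesis using that by blast
qed

text \<open>At \<open>s = t\<close> the integrand is the junk value \<open>0\<close> of the semigroup at time \<open>0\<close>, which
  makes it measurable on the closed interval.\<close>

lemma duhamel_integrand_measurable:
  assumes w: "L1_continuous_on {0..t} w"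
  shows "(\<lambda>(s, x). indicator {0..t} s * drift_semigroup m p (t - s) (w s) x) \<in> borel_measurable (borel \<Otimes>\<^sub>M borel)"
proof -
  have c: "continuous_on ({0..<t} \<times> UNIV) (\<lambda>(s, x). drift_semigroup m p (t - s) (w s) x)"
    unfolding continuous_on_sequentially
  proof (intro ballI allI impI, elim conjE)
    fix z z' assume z: "z \<in> {0..<t} \<times> (UNIV::real set)" "\<forall>n. z' n \<in> {0..<t} \<times> (UNIV::real set)" "z' \<longlonglongrightarrow> z"
    have "(\<lambda>n. drift_semigroup m p (t - fst (z' n)) (w (fst (z' n))) (snd (z' n)))
        \<longlonglongrightarrow> drift_semigroup m p (t - fst z) (w (fst z)) (snd z)"
      using z by (intro LIMSEQ_drift_semigroup_L1[OF w] tendsto_intros) (auto simp: mem_Times_iff less_imp_le)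
    then show "((\<lambda>(s, x). drift_semigroup m p (t - s) (w s) x) \<circ> z') \<longlonglongrightarrow> (case z of (s, x) \<Rightarrow> drift_semigroup m p (t - s) (w s) x)"
      by (simp add: comp_def case_prod_beta)
  qed
  have "{0..<t} \<times> (UNIV :: real set) \<in> sets (borel \<Otimes>\<^sub>M borel)" by measurable
  then have "(\<lambda>z. indicator ({0..<t} \<times> UNIV) z *\<^sub>R (case z of (s, x) \<Rightarrow> drift_semigroup m p (t - s) (w s) x)) \<in> borel_measurable (borel \<Otimes>\<^sub>M borel)"
    using borel_measurable_continuous_on_indicator[OF _ c] unfolding borel_prod by blast
  also have "(\<lambda>z. indicator ({0..<t} \<times> UNIV) z *\<^sub>R (case z of (s, x) \<Rightarrow> drift_semigroup m p (t - s) (w s) x))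
      = (\<lambda>(s, x). indicator {0..t} s * drift_semigroup m p (t - s) (w s) x)"
    by (auto simp: fun_eq_iff indicator_def)
  finally show ?thesis .
qed

text \<open>Dominated convergence in \<open>s\<close>, with the majorant uniform in
  \<open>x\<close>. This is half of the continuity of the representative of
  \<open>u t\<close>.\<close>

lemma continuous_on_duhamel:
  assumes t: "t > 0" and w: "L1_continuous_on {0..t} w"
  shows "continuous_on UNIV (duhamel m p w t)"
proof -
  obtain B where B: "B \<ge> 0" "\<And>s x. \<bar>indicator {0..t} s * drift_semigroup m p (t - s) (w s) x\<bar> \<le> B * (indicator {0..t} s * (1 / sqrt (t - s)))"
    using duhamel_integrand_le[OF w] by metis
  have meas: "(\<lambda>s. indicator {0..t} s * drift_semigroup m p (t - s) (w s) x) \<in> borel_measurable lborel" for x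
    using measurable_compose[OF measurable_Pair2'[of x borel borel] duhamel_integrand_measurable[OF w]] by simp
  have "(\<lambda>n. duhamel m p w t (y n)) \<longlonglongrightarrow> duhamel m p w t x" if y: "y \<longlonglongrightarrow> x" for y x
    unfolding duhamel_def set_lebesgue_integral_def real_scaleR_def
  proof (rule integral_dominated_convergence[where w = "\<lambda>s. B * (indicator {0..t} s * (1 / sqrt (t - s)))"])
    show "AE s in lborel. (\<lambda>n. indicator {0..t} s * drift_semigroup m p (t - s) (w s) (y n))
        \<longlonglongrightarrow> indicator {0..t} s * drift_semigroup m p (t - s) (w s) x"
    proof (intro AE_I2)
      fix s
      show "(\<lambda>n. indicator {0..t} s * drift_semigroup m p (t - s) (w s) (y n))
        \<longlonglongrightarrow> indicator {0..t} s * drift_semigroup m p (t - s) (w s) x"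
      proof (cases "s \<in> {0..<t}")
        case True
        then show ?thesis
          using w by (intro tendsto_intros LIMSEQ_drift_semigroup[OF _ _ y]) (auto simp: L1_continuous_on_def)
      next
        case False
        then show ?thesis by (cases "s = t") auto
      qed
    qed
    show "integrable lborel (\<lambda>s. B * (indicator {0..t} s * (1 / sqrt (t - s))))"
      by (intro integrable_mult_right integrable_inverse_sqrt t)
    show "AE s in lborel. norm (indicator {0..t} s * drift_semigroup m p (t - s) (w s) (y n))
        \<le> B * (indicator {0..t} s * (1 / sqrt (t - s)))" for n
      unfolding real_norm_def by (intro AE_I2 B(2))
  qed (rule meas)+
  then show ?thesis
    by (auto simp: continuous_on_sequentially comp_def)
qed

text \<open>Fubini exchanges smoothing in space with integration in time; the mass of the kernel
  times \<open>B / sqrt (t - s)\<close> dominates the inner integrals.\<close>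

lemma drift_semigroup_duhamel:
  assumes r: "r > 0" and t: "t > 0" and w: "L1_continuous_on {0..t} w"
  shows "integrable lborel (\<lambda>y. drift_kernel m p r (x - y) * duhamel m p w t y)" (is ?int)
    and "drift_semigroup m p r (duhamel m p w t) x
      = (LINT s:{0..t}|lborel. drift_semigroup m p r (drift_semigroup m p (t - s) (w s)) x)" (is ?eq)
proof -
  obtain B where B: "B \<ge> 0" "\<And>s x. \<bar>indicator {0..t} s * drift_semigroup m p (t - s) (w s) x\<bar> \<le> B * (indicator {0..t} s * (1 / sqrt (t - s)))"
    using duhamel_integrand_le[OF w] by metis
  let ?G = "\<lambda>(s, y). indicator {0..t} s * drift_semigroup m p (t - s) (w s) y"
  let ?F = "\<lambda>(s, y). drift_kernel m p r (x - y) * (indicator {0..t} s * drift_semigroup m p (t - s) (w s) y)"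
  note [measurable] = duhamel_integrand_measurable[OF w]
  have F_meas[measurable]: "?F \<in> borel_measurable (lborel \<Otimes>\<^sub>M lborel)"
  proof -
    have "(\<lambda>z. drift_kernel m p r (x - snd z) * ?G z) \<in> borel_measurable (borel \<Otimes>\<^sub>M borel)"
      by measurable
    then show ?thesis by (simp add: case_prod_beta cong: measurable_cong_sets)
  qed
  note K = integrable_drift_kernel_reflect[OF r, of m p x]
  have intF: "integrable lborel (\<lambda>y. ?F (s, y))" for s
  proof -
    have "(\<lambda>y. indicator {0..t} s * drift_semigroup m p (t - s) (w s) y) \<in> borel_measurable borel"
      using measurable_compose[OF measurable_Pair1'[of s borel borel] duhamel_integrand_measurable[OF w]] by simp
    from integrable_bounded_mult[OF K this B(2)] show ?thesis
      by (simp add: mult.commute)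
  qed
  have norm_le: "norm a \<le> norm b" if "0 \<le> a" "a \<le> b" for a b :: real
    using that by simp
  have F: "integrable (lborel \<Otimes>\<^sub>M lborel) ?F"
  proof (rule lborel_pair.Fubini_integrable[OF F_meas])
    show "AE s in lborel. integrable lborel (\<lambda>y. ?F (s, y))"
      by (intro AE_I2 intF)
    show "integrable lborel (\<lambda>s. \<integral>y. norm (?F (s, y)) \<partial>lborel)"
    proof (rule Bochner_Integration.integrable_bound)
      show "integrable lborel (\<lambda>s. (LINT y|lborel. drift_kernel m p r (x - y)) * (B * (indicator {0..t} s * (1 / sqrt (t - s)))))"
        by (intro integrable_mult_right integrable_inverse_sqrt t)
      show "(\<lambda>s. \<integral>y. norm (?F (s, y)) \<partial>lborel) \<in> borel_measurable lborel"
        by (intro lborel.borel_measurable_lebesgue_integral) measurable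
      show "AE s in lborel. norm (\<integral>y. norm (?F (s, y)) \<partial>lborel)
          \<le> norm ((LINT y|lborel. drift_kernel m p r (x - y)) * (B * (indicator {0..t} s * (1 / sqrt (t - s)))))"
      proof (intro AE_I2)
        fix s
        have "(\<integral>y. norm (?F (s, y)) \<partial>lborel) \<le> (\<integral>y. drift_kernel m p r (x - y) * (B * (indicator {0..t} s * (1 / sqrt (t - s)))) \<partial>lborel)"
        proof (intro integral_mono integrable_norm intF integrable_mult_left K)
          show "norm (?F (s, y)) \<le> drift_kernel m p r (x - y) * (B * (indicator {0..t} s * (1 / sqrt (t - s))))" for y
            unfolding prod.case real_norm_def abs_mult[of "drift_kernel m p r (x - y)"]
              abs_of_nonneg[OF drift_kernel_nonneg]
            by (intro mult_left_mono drift_kernel_nonneg B(2))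
        qed
        also have "\<dots> = (LINT y|lborel. drift_kernel m p r (x - y)) * (B * (indicator {0..t} s * (1 / sqrt (t - s))))"
          by (rule integral_mult_left_zero)
        finally have "(\<integral>y. norm (?F (s, y)) \<partial>lborel)
            \<le> (LINT y|lborel. drift_kernel m p r (x - y)) * (B * (indicator {0..t} s * (1 / sqrt (t - s))))" .
        then show "norm (\<integral>y. norm (?F (s, y)) \<partial>lborel)
          \<le> norm ((LINT y|lborel. drift_kernel m p r (x - y)) * (B * (indicator {0..t} s * (1 / sqrt (t - s)))))"
          by (rule norm_le[rotated]) (rule Bochner_Integration.integral_nonneg, rule norm_ge_zero)
      qed
    qed
  qed
  have D: "drift_kernel m p r (x - y) * duhamel m p w t y = (\<integral>s. ?F (s, y) \<partial>lborel)" for y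
    by (simp add: duhamel_def set_lebesgue_integral_def)
  show ?int
    unfolding D using lborel_pair.integrable_snd[of "\<lambda>s y. ?F (s, y)"] F by (simp add: case_prod_beta)
  have "drift_semigroup m p r (duhamel m p w t) x = (\<integral>y. \<integral>s. ?F (s, y) \<partial>lborel \<partial>lborel)"
    unfolding drift_semigroup_def D ..
  also have "\<dots> = (\<integral>s. \<integral>y. ?F (s, y) \<partial>lborel \<partial>lborel)"
    by (rule lborel_pair.Fubini_integral) (use F in \<open>simp add: case_prod_beta\<close>)
  also have "\<dots> = (LINT s:{0..t}|lborel. drift_semigroup m p r (drift_semigroup m p (t - s) (w s)) x)"
    unfolding set_lebesgue_integral_def drift_semigroup_def[of m p r]
    by (intro Bochner_Integration.integral_cong) (auto split: split_indicator)
  finally show ?eq .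
qed

lemma abs_duhamel_le:
  "ennreal \<bar>duhamel m p w t x\<bar>
    \<le> (\<integral>\<^sup>+s. ennreal \<bar>drift_semigroup m p (t - s) (w s) x\<bar> * indicator {0..t} s \<partial>lborel)"
proof -
  have "ennreal \<bar>duhamel m p w t x\<bar>
      \<le> (\<integral>\<^sup>+s. ennreal \<bar>indicator {0..t} s *\<^sub>R drift_semigroup m p (t - s) (w s) x\<bar> \<partial>lborel)"
    unfolding duhamel_def set_lebesgue_integral_def by (rule abs_integral_le_nn_integral)
  also have "\<dots> = (\<integral>\<^sup>+s. ennreal \<bar>drift_semigroup m p (t - s) (w s) x\<bar> * indicator {0..t} s \<partial>lborel)"
    by (intro nn_integral_cong) (auto split: split_indicator)
  finally show ?thesis .
qed

text \<open>The semigroup law merges the times \<open>r\<close> and \<open>t - s\<close> into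
  \<open>r + t - s\<close>. The case distinction stands for the identity at \<open>r = 0\<close>,
  where \<open>drift_semigroup\<close> is zero, so that pointwise and smoothed bounds share one
  statement.\<close>

lemma abs_drift_semigroup_mild_le:
  fixes m p :: real
  assumes r: "r \<ge> 0" and t: "t > 0" and f: "integrable lborel f" and w: "L1_continuous_on {0..t} w"
  defines "v \<equiv> \<lambda>x. drift_semigroup m p t f x + duhamel m p w t x"
  shows "ennreal \<bar>if r = 0 then v x else drift_semigroup m p r v x\<bar>
    \<le> ennreal \<bar>drift_semigroup m p (r + t) f x\<bar>
      + (\<integral>\<^sup>+s. ennreal \<bar>drift_semigroup m p (r + t - s) (w s) x\<bar> * indicator {0..t} s \<partial>lborel)"
proof (cases "r = 0")
  case True
  have "ennreal \<bar>v x\<bar> \<le> ennreal \<bar>drift_semigroup m p t f x\<bar> + ennreal \<bar>duhamel m p w t x\<bar>"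
    unfolding v_def by (rule ennreal_abs_add_le)
  also have "\<dots> \<le> ennreal \<bar>drift_semigroup m p t f x\<bar>
      + (\<integral>\<^sup>+s. ennreal \<bar>drift_semigroup m p (t - s) (w s) x\<bar> * indicator {0..t} s \<partial>lborel)"
    by (intro add_left_mono abs_duhamel_le)
  finally show ?thesis using True by simp
next
  case False
  then have r: "r > 0" using r by simp
  note K = integrable_drift_kernel_reflect[OF r, of m p x]
  have "integrable lborel (\<lambda>y. drift_semigroup m p t f y * drift_kernel m p r (x - y))"
    by (rule integrable_bounded_mult[OF K drift_semigroup_measurable[OF t f] drift_semigroup_le[OF t f]])
  then have "drift_semigroup m p r v x = drift_semigroup m p r (drift_semigroup m p t f) x
      + drift_semigroup m p r (duhamel m p w t) x"
    unfolding drift_semigroup_def[of m p r] v_def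
    using drift_semigroup_duhamel(1)[OF r t w] by (simp add: distrib_left mult.commute)
  also have "drift_semigroup m p r (drift_semigroup m p t f) x = drift_semigroup m p (r + t) f x"
    by (rule drift_semigroup_semigroup[OF r t f])
  finally have "ennreal \<bar>drift_semigroup m p r v x\<bar> \<le> ennreal \<bar>drift_semigroup m p (r + t) f x\<bar>
      + ennreal \<bar>drift_semigroup m p r (duhamel m p w t) x\<bar>"
    using ennreal_abs_add_le by simp
  also have "ennreal \<bar>drift_semigroup m p r (duhamel m p w t) x\<bar>
      \<le> (\<integral>\<^sup>+s. ennreal \<bar>indicator {0..t} s *\<^sub>R drift_semigroup m p r (drift_semigroup m p (t - s) (w s)) x\<bar> \<partial>lborel)"
    unfolding drift_semigroup_duhamel(2)[OF r t w] set_lebesgue_integral_def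
    by (rule abs_integral_le_nn_integral)
  also have "\<dots> \<le> (\<integral>\<^sup>+s. ennreal \<bar>drift_semigroup m p (r + t - s) (w s) x\<bar> * indicator {0..t} s \<partial>lborel)"
  proof (intro nn_integral_mono)
    fix s
    have "\<bar>drift_semigroup m p r (drift_semigroup m p (t - s) (w s)) x\<bar> \<le> \<bar>drift_semigroup m p (r + t - s) (w s) x\<bar>"
      if s: "s \<in> {0..t}"
    proof (cases "s = t")
      \<comment> \<open>Here the inner semigroup is the zero function, so the left side is
        0.\<close>
      case True
      then show ?thesis by (simp add: drift_semigroup_def)
    next
      case False
      then show ?thesis
        using s w by (subst drift_semigroup_semigroup[OF r]) (auto simp: L1_continuous_on_def algebra_simps)
    qed
    then show "ennreal \<bar>indicator {0..t} s *\<^sub>R drift_semigroup m p r (drift_semigroup m p (t - s) (w s)) x\<bar>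
        \<le> ennreal \<bar>drift_semigroup m p (r + t - s) (w s) x\<bar> * indicator {0..t} s"
      by (auto split: split_indicator intro!: ennreal_leI)
  qed
  finally show ?thesis using False by (simp add: add_left_mono)
qed

section \<open>Bounds as Gaussian mixtures\<close>

lemma nn_integral_exp_square:
  assumes "r > 0"
  shows "(\<integral>\<^sup>+\<xi>. ennreal (exp (- (\<xi>\<^sup>2 * r))) \<partial>lborel) = ennreal (sqrt (pi / r))"
proof -
  define \<sigma> where "\<sigma> = sqrt (1 / (2 * r))"
  have \<sigma>: "\<sigma> > 0" "\<sigma>\<^sup>2 = 1 / (2 * r)" using assms by (auto simp: \<sigma>_def)
  have eq: "exp (- (\<xi>\<^sup>2 * r)) = sqrt (pi / r) * normal_density 0 \<sigma> \<xi>" for \<xi>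
    using assms unfolding normal_density_def \<sigma>(2) by simp
  have "(\<integral>\<^sup>+\<xi>. ennreal (exp (- (\<xi>\<^sup>2 * r))) \<partial>lborel)
      = ennreal (sqrt (pi / r)) * (\<integral>\<^sup>+\<xi>. ennreal (normal_density 0 \<sigma> \<xi>) \<partial>lborel)"
    unfolding eq using assms by (simp add: ennreal_mult nn_integral_cmult)
  also have "(\<integral>\<^sup>+\<xi>. ennreal (normal_density 0 \<sigma> \<xi>) \<partial>lborel) = 1"
    using \<sigma>(1) by (simp add: nn_integral_eq_integral)
  finally show ?thesis by simp
qed

text \<open>The arctangent integral over the whole line, rescaled by \<open>sqrt b\<close>.\<close>

lemma nn_integral_inverse_1_plus_square:
  assumes "b > 0"
  shows "(\<integral>\<^sup>+\<xi>. ennreal (1 / (1 + b * \<xi>\<^sup>2)) \<partial>lborel) = ennreal (pi / sqrt b)"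
proof -
  have "has_bochner_integral lborel (\<lambda>x::real. inverse (1 + x\<^sup>2)) pi"
    using LBINT_inverse_1_plus_square integrable_inverse_1_plus_square
    by (simp add: has_bochner_integral_iff interval_lebesgue_integral_def set_integrable_def set_lebesgue_integral_def einterval_def)
  then have "(\<integral>\<^sup>+x. ennreal (inverse (1 + x\<^sup>2)) \<partial>lborel) = ennreal pi" (is "?I = _")
    by (subst nn_integral_eq_integral) (auto simp: has_bochner_integral_iff)
  moreover have "?I = ennreal (sqrt b) * (\<integral>\<^sup>+\<xi>. ennreal (1 / (1 + b * \<xi>\<^sup>2)) \<partial>lborel)" (is "_ = _ * ?J")
    using assms
    by (subst nn_integral_real_affine[of _ "sqrt b" 0]) (auto simp: power_mult_distrib inverse_eq_divide)
  ultimately have J: "ennreal (sqrt b) * ?J = ennreal pi" by simp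
  have "?J = ennreal (1 / sqrt b) * (ennreal (sqrt b) * ?J)"
  proof -
    have "ennreal (1 / sqrt b) * ennreal (sqrt b) = 1"
      using assms by (subst ennreal_mult[symmetric]) auto
    then show ?thesis by (simp add: mult.assoc[symmetric])
  qed
  also have "\<dots> = ennreal (pi / sqrt b)"
    unfolding J using assms by (simp add: ennreal_mult[symmetric])
  finally show ?thesis .
qed

text \<open>The Gaussian integral shows that the right side equals the smoothing estimate, with
  \<open>1 / sqrt (4 * pi * t)\<close> rewritten as a mixture over the modes \<xi>.\<close>

lemma drift_semigroup_le_nn_integral:
  assumes t: "t > 0" and f: "integrable lborel f" "L1_norm f \<le> C"
  shows "ennreal \<bar>drift_semigroup m p t f x\<bar>
    \<le> ennreal (C / (2 * pi)) * (\<integral>\<^sup>+\<xi>. ennreal (exp ((p - \<xi>\<^sup>2) * t)) \<partial>lborel)"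
proof -
  have C: "C \<ge> 0" using f(2) L1_norm_nonneg[of f] by linarith
  have "(\<integral>\<^sup>+\<xi>. ennreal (exp ((p - \<xi>\<^sup>2) * t)) \<partial>lborel)
      = (\<integral>\<^sup>+\<xi>. ennreal (exp (p * t)) * ennreal (exp (- (\<xi>\<^sup>2 * t))) \<partial>lborel)"
    by (intro nn_integral_cong) (simp add: ennreal_mult[symmetric] exp_add[symmetric] algebra_simps)
  also have "\<dots> = ennreal (exp (p * t) * sqrt (pi / t))"
    using t by (subst nn_integral_cmult) (auto simp: nn_integral_exp_square ennreal_mult)
  finally have eq: "ennreal (C / (2 * pi)) * (\<integral>\<^sup>+\<xi>. ennreal (exp ((p - \<xi>\<^sup>2) * t)) \<partial>lborel)
      = ennreal (C / (2 * pi) * (exp (p * t) * sqrt (pi / t)))"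
    using C t by (simp add: ennreal_mult[symmetric])
  have "\<bar>drift_semigroup m p t f x\<bar> \<le> exp (p * t) / sqrt (4 * pi * t) * C"
    using drift_semigroup_le[OF t f(1)] mult_left_mono[OF f(2), of "exp (p * t) / sqrt (4 * pi * t)"] t
    by (meson divide_nonneg_nonneg exp_ge_zero order_trans real_sqrt_ge_zero less_imp_le mult_nonneg_nonneg pi_ge_zero zero_le_numeral)
  also have "\<dots> = C / (2 * pi) * (exp (p * t) * sqrt (pi / t))"
  proof -
    have "sqrt pi * sqrt pi = pi" by simp
    then show ?thesis
      using t by (simp add: real_sqrt_mult real_sqrt_divide field_simps)
  qed
  finally show ?thesis unfolding eq by (rule ennreal_leI)
qed

text \<open>\<open>exp (\<Lambda> \<xi> * t)\<close> is a supersolution of the delay equation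
  \<open>y' = (p - \<xi>\<^sup>2) y + q y(t - \<eta>)\<close> satisfied by the Fourier mode \<open>\<xi>\<close>.\<close>

lemma mild_bound_step:
  fixes \<Lambda> :: "real \<Rightarrow> real"
  assumes r: "r \<ge> 0" and t: "t > 0" and q: "q \<ge> 0" and c: "c \<ge> 0"
    and [measurable]: "\<Lambda> \<in> borel_measurable borel"
    and super: "\<And>\<xi>. q * exp (- \<eta> * \<Lambda> \<xi>) \<le> \<Lambda> \<xi> + \<xi>\<^sup>2 - p"
    and f: "\<And>\<rho>. \<rho> > 0 \<Longrightarrow> ennreal \<bar>drift_semigroup m p \<rho> f x\<bar>
        \<le> ennreal c * (\<integral>\<^sup>+\<xi>. ennreal (exp ((p - \<xi>\<^sup>2) * \<rho>)) \<partial>lborel)"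
    and w: "\<And>\<rho> s. \<rho> > 0 \<Longrightarrow> 0 \<le> s \<Longrightarrow> s \<le> t \<Longrightarrow> ennreal \<bar>drift_semigroup m p \<rho> (w s) x\<bar>
        \<le> ennreal (c * q) * (\<integral>\<^sup>+\<xi>. ennreal (exp ((p - \<xi>\<^sup>2) * \<rho> + \<Lambda> \<xi> * (s - \<eta>))) \<partial>lborel)"
  shows "ennreal \<bar>drift_semigroup m p (r + t) f x\<bar>
      + (\<integral>\<^sup>+s. ennreal \<bar>drift_semigroup m p (r + t - s) (w s) x\<bar> * indicator {0..t} s \<partial>lborel)
    \<le> ennreal c * (\<integral>\<^sup>+\<xi>. ennreal (exp ((p - \<xi>\<^sup>2) * r + \<Lambda> \<xi> * t)) \<partial>lborel)"
proof -
  let ?e = "\<lambda>s \<xi>. exp ((p - \<xi>\<^sup>2) * (r + t - s) + \<Lambda> \<xi> * (s - \<eta>))"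
  let ?E = "\<lambda>\<xi>. exp ((p - \<xi>\<^sup>2) * (r + t))"
  let ?F = "\<lambda>\<xi>. exp ((p - \<xi>\<^sup>2) * r + \<Lambda> \<xi> * t)"
  \<comment> \<open>For fixed \<xi> the supersolution inequality bounds the integrand by the
    derivative of \<open>?G\<close>, whose values at \<open>t\<close> and 0 are \<open>?F\<close>
    and \<open>?E\<close>.\<close>
  have inner: "(\<integral>\<^sup>+s. ennreal (q * ?e s \<xi>) * indicator {0..t} s \<partial>lborel) \<le> ennreal (?F \<xi> - ?E \<xi>)" for \<xi>
  proof -
    let ?G = "\<lambda>s. exp ((p - \<xi>\<^sup>2) * (r + t - s) + \<Lambda> \<xi> * s)"
    have pos: "0 \<le> \<Lambda> \<xi> + \<xi>\<^sup>2 - p"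
      using super[of \<xi>] q by (smt (verit) exp_ge_zero mult_nonneg_nonneg)
    have "q * ?e s \<xi> \<le> (\<Lambda> \<xi> + \<xi>\<^sup>2 - p) * ?G s" for s
    proof -
      have "q * ?e s \<xi> = q * exp (- \<eta> * \<Lambda> \<xi>) * ?G s"
        by (simp add: mult.assoc exp_add[symmetric] algebra_simps)
      also have "\<dots> \<le> (\<Lambda> \<xi> + \<xi>\<^sup>2 - p) * ?G s"
        by (intro mult_right_mono super) simp
      finally show ?thesis .
    qed
    then have "(\<integral>\<^sup>+s. ennreal (q * ?e s \<xi>) * indicator {0..t} s \<partial>lborel)
        \<le> (\<integral>\<^sup>+s. ennreal ((\<Lambda> \<xi> + \<xi>\<^sup>2 - p) * ?G s) * indicator {0..t} s \<partial>lborel)"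
      by (intro nn_integral_mono mult_right_mono ennreal_leI) auto
    also have "\<dots> = ennreal (?G t - ?G 0)"
    proof (rule nn_integral_FTC_Icc)
      show "(?G has_real_derivative (\<Lambda> \<xi> + \<xi>\<^sup>2 - p) * ?G s) (at s)" for s
        by (auto intro!: derivative_eq_intros simp: algebra_simps)
    qed (use t pos in auto)
    finally show ?thesis by simp
  qed
  have "(\<integral>\<^sup>+s. ennreal \<bar>drift_semigroup m p (r + t - s) (w s) x\<bar> * indicator {0..t} s \<partial>lborel)
      \<le> (\<integral>\<^sup>+s. ennreal c * (\<integral>\<^sup>+\<xi>. ennreal (q * ?e s \<xi>) * indicator {0..t} s \<partial>lborel) \<partial>lborel)"
  proof (intro nn_integral_mono)
    fix s
    show "ennreal \<bar>drift_semigroup m p (r + t - s) (w s) x\<bar> * indicator {0..t} s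
        \<le> ennreal c * (\<integral>\<^sup>+\<xi>. ennreal (q * ?e s \<xi>) * indicator {0..t} s \<partial>lborel)"
    \<comment> \<open>Within the interval, \<open>r + t - s = 0\<close> happens only for
      \<open>r = 0\<close> and \<open>s = t\<close>. The hypothesis on \<open>w\<close> needs a
      positive time, but there the left side is 0.\<close>
    proof (cases "s \<in> {0..t} \<and> r + t - s > 0")
      case True
      then have "ennreal \<bar>drift_semigroup m p (r + t - s) (w s) x\<bar>
          \<le> ennreal (c * q) * (\<integral>\<^sup>+\<xi>. ennreal (?e s \<xi>) \<partial>lborel)"
        by (intro w) auto
      also have "\<dots> = ennreal c * (\<integral>\<^sup>+\<xi>. ennreal (q * ?e s \<xi>) \<partial>lborel)"
        using c q by (simp add: ennreal_mult nn_integral_cmult mult.assoc)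
      finally show ?thesis using True by simp
    next
      case False
      then show ?thesis using r by (cases "r + t - s = 0") (auto split: split_indicator)
    qed
  qed
  also have "\<dots> = ennreal c * (\<integral>\<^sup>+s. (\<integral>\<^sup>+\<xi>. ennreal (q * ?e s \<xi>) * indicator {0..t} s \<partial>lborel) \<partial>lborel)"
    by (intro nn_integral_cmult lborel.borel_measurable_nn_integral) measurable
  also have "(\<integral>\<^sup>+s. (\<integral>\<^sup>+\<xi>. ennreal (q * ?e s \<xi>) * indicator {0..t} s \<partial>lborel) \<partial>lborel)
      = (\<integral>\<^sup>+\<xi>. (\<integral>\<^sup>+s. ennreal (q * ?e s \<xi>) * indicator {0..t} s \<partial>lborel) \<partial>lborel)"
    by (rule lborel_pair.Fubini'[symmetric]) measurable
  also have "\<dots> \<le> (\<integral>\<^sup>+\<xi>. ennreal (?F \<xi> - ?E \<xi>) \<partial>lborel)"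
    by (intro nn_integral_mono inner)
  finally have "(\<integral>\<^sup>+s. ennreal \<bar>drift_semigroup m p (r + t - s) (w s) x\<bar> * indicator {0..t} s \<partial>lborel)
      \<le> ennreal c * (\<integral>\<^sup>+\<xi>. ennreal (?F \<xi> - ?E \<xi>) \<partial>lborel)"
    by (simp add: mult_left_mono)
  moreover have "ennreal \<bar>drift_semigroup m p (r + t) f x\<bar> \<le> ennreal c * (\<integral>\<^sup>+\<xi>. ennreal (?E \<xi>) \<partial>lborel)"
    using r t by (intro f) simp
  ultimately have "ennreal \<bar>drift_semigroup m p (r + t) f x\<bar>
      + (\<integral>\<^sup>+s. ennreal \<bar>drift_semigroup m p (r + t - s) (w s) x\<bar> * indicator {0..t} s \<partial>lborel)
    \<le> ennreal c * (\<integral>\<^sup>+\<xi>. ennreal (?E \<xi>) \<partial>lborel) + ennreal c * (\<integral>\<^sup>+\<xi>. ennreal (?F \<xi> - ?E \<xi>) \<partial>lborel)"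
    by (rule add_mono[rotated])
  also have "\<dots> = ennreal c * (\<integral>\<^sup>+\<xi>. ennreal (?E \<xi>) + ennreal (?F \<xi> - ?E \<xi>) \<partial>lborel)"
    by (simp add: distrib_left[symmetric] nn_integral_add)
  also have "\<dots> = ennreal c * (\<integral>\<^sup>+\<xi>. ennreal (?F \<xi>) \<partial>lborel)"
  proof -
    \<comment> \<open>Needed because \<open>ennreal\<close> truncates negative reals: only then do
      \<open>?E\<close> and \<open>?F - ?E\<close> add up to \<open>?F\<close>.\<close>
    have "?E \<xi> \<le> ?F \<xi>" for \<xi>
    proof -
      have "0 \<le> \<Lambda> \<xi> + \<xi>\<^sup>2 - p"
        using super[of \<xi>] q by (smt (verit) exp_ge_zero mult_nonneg_nonneg)
      then have "0 \<le> (\<Lambda> \<xi> + \<xi>\<^sup>2 - p) * t" using t by simp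
      then show ?thesis by (simp add: algebra_simps)
    qed
    then show ?thesis by (simp add: ennreal_plus[symmetric] del: ennreal_plus)
  qed
  finally show ?thesis .
qed

section \<open>The supersolution\<close>

text \<open>The difference of the two sides is strictly increasing, at most 0 at \<open>p\<close>
  and at least 0 at 0, the latter being \<open>- p \<ge> q\<close>.\<close>

lemma delay_root:
  fixes h p q :: real
  assumes h: "h > 0" and q: "- p \<ge> q" "q \<ge> 0"
  obtains g where "g - p = q * exp (- h * g)" "g \<le> 0" "\<And>g'. g' - p = q * exp (- h * g') \<Longrightarrow> g' = g"
proof -
  let ?f = "\<lambda>g. g - p - q * exp (- h * g)"
  have "\<exists>g\<ge>p. g \<le> 0 \<and> ?f g = 0"
    using q by (intro IVT) (auto intro!: continuous_intros)
  then obtain g where g: "g \<le> 0" "?f g = 0" by blast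
  have mono: "?f a < ?f b" if "a < b" for a b
  proof -
    have "exp (- h * b) \<le> exp (- h * a)" using h that by simp
    then have "q * exp (- h * b) \<le> q * exp (- h * a)" using q by (intro mult_left_mono)
    then show ?thesis using that by simp
  qed
  have "g' = g" if "g' - p = q * exp (- h * g')" for g'
  proof -
    have "?f g' = 0" using that by simp
    then show ?thesis using mono[of g g'] mono[of g' g] g(2) by linarith
  qed
  moreover have "g - p = q * exp (- h * g)" using g(2) by simp
  ultimately show ?thesis using that g(1) by blast
qed

text \<open>Bernoulli's inequality \<open>1 + a * x \<le> (1 + x) powr a\<close> in logarithmic
  form: the difference vanishes at 0 and has nonnegative derivative.\<close>

lemma ln_one_plus_mult_le:
  fixes a x :: real
  assumes a: "a \<ge> 1" and x: "x \<ge> 0"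
  shows "ln (1 + a * x) \<le> a * ln (1 + x)"
proof -
  have "a * ln (1 + 0) - ln (1 + a * 0) \<le> a * ln (1 + x) - ln (1 + a * x)"
  proof (rule DERIV_nonneg_imp_nondecreasing[OF x], intro exI conjI)
    fix y :: real assume y: "0 \<le> y" "y \<le> x"
    have pos: "1 + a * y > 0" using a y by (simp add: add_pos_nonneg)
    show "((\<lambda>y. a * ln (1 + y) - ln (1 + a * y)) has_real_derivative a / (1 + y) - a / (1 + a * y)) (at y)"
      using y pos by (auto intro!: derivative_eq_intros simp: divide_simps)
    have "1 * y \<le> a * y" using a y by (intro mult_right_mono)
    then show "0 \<le> a / (1 + y) - a / (1 + a * y)"
      using a y pos by (auto intro!: divide_left_mono mult_pos_pos)
  qed
  then show ?thesis by simp
qed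

text \<open>With \<open>\<kappa> = 1 + h * (\<gamma> - p)\<close> this agrees to first order in
  \<open>\<xi>\<^sup>2\<close> with the real characteristic root of the mode \<xi> with delay
  \<open>h\<close>. The logarithm makes
  \<open>exp (- \<eta> * mode_rate \<gamma> \<kappa> \<eta> \<xi>)\<close> affine in
  \<open>\<xi>\<^sup>2\<close>.\<close>

definition mode_rate :: "real \<Rightarrow> real \<Rightarrow> real \<Rightarrow> real \<Rightarrow> real" where
  "mode_rate \<gamma> \<kappa> \<eta> \<xi> = \<gamma> - ln (1 + \<eta> * (\<xi>\<^sup>2 / \<kappa>)) / \<eta>"

lemma mode_rate_measurable [measurable]: "mode_rate \<gamma> \<kappa> \<eta> \<in> borel_measurable borel"
  unfolding mode_rate_def[abs_def] by measurable

lemma mode_rate_nonpos: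
  assumes "\<gamma> \<le> 0" "\<eta> > 0" "\<kappa> > 0"
  shows "mode_rate \<gamma> \<kappa> \<eta> \<xi> \<le> 0"
proof -
  have "0 \<le> ln (1 + \<eta> * (\<xi>\<^sup>2 / \<kappa>)) / \<eta>"
    using assms by (intro divide_nonneg_pos ln_ge_zero) auto
  then show ?thesis using assms(1) unfolding mode_rate_def by linarith
qed

text \<open>With \<open>k = \<gamma> - p\<close> and \<open>z = \<xi>\<^sup>2 / \<kappa>\<close>,
  the choice of \<kappa> means \<open>\<xi>\<^sup>2 = z + h * k * z\<close>. The left side is at
  most \<open>k * (1 + \<eta> * z)\<close>, hence at most \<open>k + h * k * z\<close>; the right
  side exceeds this by \<open>z - ln (1 + \<eta> * z) / \<eta>\<close>, which is nonnegative. The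
  bound \<open>\<eta> \<le> h\<close> enters twice: with \<open>\<gamma> \<le> 0\<close> it replaces
  \<open>exp (- \<eta> * \<gamma>)\<close> by \<open>exp (- h * \<gamma>)\<close>, and it gives
  \<open>\<eta> * k * z \<le> h * k * z\<close>.\<close>

lemma mode_rate_supersolution:
  assumes \<gamma>: "\<gamma> - p = q * exp (- h * \<gamma>)" "\<gamma> \<le> 0" and q: "q \<ge> 0" and \<eta>: "0 < \<eta>" "\<eta> \<le> h"
  defines "\<kappa> \<equiv> 1 + h * (\<gamma> - p)"
  shows "q * exp (- \<eta> * mode_rate \<gamma> \<kappa> \<eta> \<xi>) \<le> mode_rate \<gamma> \<kappa> \<eta> \<xi> + \<xi>\<^sup>2 - p"
proof -
  define k where "k = \<gamma> - p"
  define z where "z = \<xi>\<^sup>2 / \<kappa>"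
  have k: "k \<ge> 0" using \<gamma> q by (simp add: k_def)
  have \<kappa>: "\<kappa> = 1 + h * k" by (simp add: \<kappa>_def k_def)
  have \<kappa>1: "\<kappa> \<ge> 1" using k \<eta> by (simp add: \<kappa>)
  have "\<xi>\<^sup>2 = \<kappa> * z" using \<kappa>1 by (simp add: z_def)
  then have z: "\<xi>\<^sup>2 = z + h * k * z" by (simp add: \<kappa> distrib_right)
  have z0: "z \<ge> 0" using \<kappa>1 by (simp add: z_def)
  have pos: "0 < 1 + \<eta> * z" using \<eta> z0 by (simp add: add_pos_nonneg)
  have ex: "exp (- \<eta> * mode_rate \<gamma> \<kappa> \<eta> \<xi>) = exp (- \<eta> * \<gamma>) * (1 + \<eta> * z)"
  proof -
    have "- \<eta> * mode_rate \<gamma> \<kappa> \<eta> \<xi> = - \<eta> * \<gamma> + ln (1 + \<eta> * z)"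
      using \<eta> by (simp add: mode_rate_def z_def right_diff_distrib)
    then show ?thesis using pos by (simp only: exp_add exp_ln)
  qed
  have "- \<eta> * \<gamma> \<le> - h * \<gamma>"
    using \<eta> \<gamma> by (simp add: mult_right_mono_neg)
  then have "q * exp (- \<eta> * \<gamma>) \<le> k"
    unfolding k_def \<gamma>(1) using q by (intro mult_left_mono) auto
  then have "q * exp (- \<eta> * mode_rate \<gamma> \<kappa> \<eta> \<xi>) \<le> k * (1 + \<eta> * z)"
    unfolding ex mult.assoc[symmetric] using pos by (intro mult_right_mono) auto
  also have "\<dots> \<le> k + h * k * z"
    using mult_right_mono[OF \<eta>(2), of "k * z"] k z0 by (simp add: algebra_simps)
  also have "\<dots> \<le> mode_rate \<gamma> \<kappa> \<eta> \<xi> + \<xi>\<^sup>2 - p"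
  proof -
    have "ln (1 + \<eta> * z) \<le> \<eta> * z"
      using \<eta> z0 by (intro ln_add_one_self_le_self) auto
    then have "ln (1 + \<eta> * z) / \<eta> \<le> z"
      using \<eta> by (simp add: pos_divide_le_eq mult.commute)
    then show ?thesis
      unfolding mode_rate_def z_def[symmetric] using z k_def by linarith
  qed
  finally show ?thesis .
qed

text \<open>Bernoulli's inequality with exponent \<open>t / \<eta>\<close>, which is at least 1
  because \<open>\<eta> \<le> t\<close>.\<close>

lemma exp_mode_rate_le:
  assumes "0 < \<eta>" "\<eta> \<le> t" "\<kappa> > 0"
  shows "exp (mode_rate \<gamma> \<kappa> \<eta> \<xi> * t) \<le> exp (\<gamma> * t) * (1 / (1 + t / \<kappa> * \<xi>\<^sup>2))"
proof -
  define z where "z = \<xi>\<^sup>2 / \<kappa>"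
  have z: "z \<ge> 0" using assms by (simp add: z_def)
  have pos: "1 + t * z > 0" using assms z by (simp add: add_pos_nonneg)
  have "ln (1 + t / \<eta> * (\<eta> * z)) \<le> t / \<eta> * ln (1 + \<eta> * z)"
    using assms z by (intro ln_one_plus_mult_le) auto
  moreover have "mode_rate \<gamma> \<kappa> \<eta> \<xi> * t = \<gamma> * t - t / \<eta> * ln (1 + \<eta> * z)"
    by (simp add: mode_rate_def z_def algebra_simps)
  ultimately have "mode_rate \<gamma> \<kappa> \<eta> \<xi> * t \<le> \<gamma> * t - ln (1 + t * z)"
    using assms by simp
  then have "exp (mode_rate \<gamma> \<kappa> \<eta> \<xi> * t) \<le> exp (\<gamma> * t - ln (1 + t * z))" by simp
  also have "\<dots> = exp (\<gamma> * t) * (1 / (1 + t * z))"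
    using pos by (simp add: exp_diff)
  finally show ?thesis by (simp add: z_def)
qed

section \<open>The delay term as a source, and the right-hand side of the mild formula\<close>

lemma L1_continuous_on_delay_term:
  assumes u: "L1_continuous_on {-h..} u"
  shows "L1_continuous_on {0..t} (\<lambda>s y. q * u (s - h) (y + d))"
  unfolding L1_continuous_on_def
proof (intro conjI ballI)
  have int: "integrable lborel (u a)" if "a \<ge> - h" for a
    using u that by (auto simp: L1_continuous_on_def)
  show "integrable lborel (\<lambda>y. q * u (s - h) (y + d))" if "s \<in> {0..t}" for s
    using lborel_integrable_real_affine[OF int[of "s - h"], of 1 d] that by (simp add: add.commute)
  fix a assume a: "a \<in> {0..t}"
  have norm: "L1_norm (\<lambda>x. q * u (s - h) (x + d) - q * u (a - h) (x + d))
      = \<bar>q\<bar> * L1_norm (\<lambda>x. u (s - h) x - u (a - h) x)" for s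
    using lborel_integral_real_affine[of 1 "\<lambda>x. \<bar>u (s - h) x - u (a - h) x\<bar>" d]
    by (simp add: L1_norm_def right_diff_distrib[symmetric] abs_mult add.commute)
  have "((\<lambda>b. L1_norm (\<lambda>x. u b x - u (a - h) x)) \<longlongrightarrow> 0) (at (a - h) within {-h..})"
    using u a by (auto simp: L1_continuous_on_def)
  moreover have "filterlim (\<lambda>s. s - h) (at (a - h) within {-h..}) (at a within {0..t})"
    by (auto simp: filterlim_at eventually_at_filter intro!: tendsto_intros)
  ultimately have "((\<lambda>s. L1_norm (\<lambda>x. u (s - h) x - u (a - h) x)) \<longlongrightarrow> 0) (at a within {0..t})"
    by (rule filterlim_compose)
  then show "((\<lambda>s. L1_norm (\<lambda>x. q * u (s - h) (x + d) - q * u (a - h) (x + d))) \<longlongrightarrow> 0) (at a within {0..t})"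
    unfolding norm by (rule tendsto_mult_right_zero)
qed

text \<open>For \<open>t > 0\<close> this is the continuous representative of the class of
  \<open>u t\<close>; pointwise bounds are stated for it.\<close>

definition mild_rhs ::
  "real \<Rightarrow> real \<Rightarrow> real \<Rightarrow> real \<Rightarrow> real \<Rightarrow> (real \<Rightarrow> real) \<Rightarrow> (real \<Rightarrow> real \<Rightarrow> real) \<Rightarrow> real \<Rightarrow> real \<Rightarrow> real"
where
  "mild_rhs h m p q d f u t x =
     drift_semigroup m p t f x + duhamel m p (\<lambda>s y. q * u (s - h) (y + d)) t x"

lemma continuous_on_mild_rhs:
  assumes "t > 0" "integrable lborel f" "L1_continuous_on {-h..} u"
  shows "continuous_on UNIV (mild_rhs h m p q d f u t)"
proof -
  have "continuous_on UNIV (drift_semigroup m p t f)"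
    unfolding continuous_on_sequentially comp_def
    by (auto intro!: LIMSEQ_drift_semigroup assms)
  then show ?thesis
    unfolding mild_rhs_def[abs_def]
    by (intro continuous_on_add continuous_on_duhamel L1_continuous_on_delay_term assms)
qed

text \<open>One time step of the propagation. The history at time \<open>s - h\<close> is measured
  by the weight at \<open>s - \<eta>\<close>, so the comparison delay \<eta> may differ from
  \<open>h\<close>. Taking \<open>r = 0\<close> yields the pointwise bound, \<open>r > 0\<close> the
  smoothed one.\<close>

lemma mild_rhs_bound:
  fixes \<Lambda> :: "real \<Rightarrow> real"
  assumes t: "t > 0" and q: "q \<ge> 0" and f: "integrable lborel f" "L1_norm f \<le> C"
    and u: "L1_continuous_on {-h..} u"
    and \<Lambda>: "\<Lambda> \<in> borel_measurable borel" "\<And>\<xi>. q * exp (- \<eta> * \<Lambda> \<xi>) \<le> \<Lambda> \<xi> + \<xi>\<^sup>2 - p"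
    and hist: "\<And>\<rho> s x. \<rho> > 0 \<Longrightarrow> 0 \<le> s \<Longrightarrow> s \<le> t \<Longrightarrow> ennreal \<bar>drift_semigroup m p \<rho> (u (s - h)) x\<bar>
        \<le> ennreal (C / (2 * pi)) * (\<integral>\<^sup>+\<xi>. ennreal (exp ((p - \<xi>\<^sup>2) * \<rho> + \<Lambda> \<xi> * (s - \<eta>))) \<partial>lborel)"
    and r: "r \<ge> 0"
  shows "ennreal \<bar>if r = 0 then mild_rhs h m p q d f u t x else drift_semigroup m p r (mild_rhs h m p q d f u t) x\<bar>
    \<le> ennreal (C / (2 * pi)) * (\<integral>\<^sup>+\<xi>. ennreal (exp ((p - \<xi>\<^sup>2) * r + \<Lambda> \<xi> * t)) \<partial>lborel)"
proof -
  have C: "C / (2 * pi) \<ge> 0" using f(2) L1_norm_nonneg[of f] by simp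
  note w = L1_continuous_on_delay_term[OF u, of t q d]
  show ?thesis
    unfolding mild_rhs_def[abs_def]
  proof (rule order_trans[OF abs_drift_semigroup_mild_le[OF r t f(1) w] mild_bound_step[OF r t q C \<Lambda>]])
    fix \<rho> :: real assume \<rho>: "\<rho> > 0"
    show "ennreal \<bar>drift_semigroup m p \<rho> f x\<bar>
        \<le> ennreal (C / (2 * pi)) * (\<integral>\<^sup>+\<xi>. ennreal (exp ((p - \<xi>\<^sup>2) * \<rho>)) \<partial>lborel)"
      by (rule drift_semigroup_le_nn_integral[OF \<rho> f])
    fix s assume s: "0 \<le> s" "s \<le> t"
    have "ennreal \<bar>drift_semigroup m p \<rho> (\<lambda>y. q * u (s - h) (y + d)) x\<bar>
        = ennreal q * ennreal \<bar>drift_semigroup m p \<rho> (u (s - h)) (x + d)\<bar>"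
      using q by (simp add: drift_semigroup_cmult_shift abs_mult ennreal_mult)
    also have "\<dots> \<le> ennreal q * (ennreal (C / (2 * pi))
        * (\<integral>\<^sup>+\<xi>. ennreal (exp ((p - \<xi>\<^sup>2) * \<rho> + \<Lambda> \<xi> * (s - \<eta>))) \<partial>lborel))"
      by (intro mult_left_mono hist \<rho> s) simp
    also have "\<dots> = ennreal (C / (2 * pi) * q)
        * (\<integral>\<^sup>+\<xi>. ennreal (exp ((p - \<xi>\<^sup>2) * \<rho> + \<Lambda> \<xi> * (s - \<eta>))) \<partial>lborel)"
      unfolding ennreal_mult[OF C q] by (simp only: mult_ac)
    finally show "ennreal \<bar>drift_semigroup m p \<rho> (\<lambda>y. q * u (s - h) (y + d)) x\<bar>
        \<le> ennreal (C / (2 * pi) * q)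
          * (\<integral>\<^sup>+\<xi>. ennreal (exp ((p - \<xi>\<^sup>2) * \<rho> + \<Lambda> \<xi> * (s - \<eta>))) \<partial>lborel)" .
  qed
qed

section \<open>The delay equation\<close>

text \<open>As \<Lambda> and \<sigma> are both nonpositive, the weight
  \<open>exp (\<Lambda> \<xi> * \<sigma>)\<close> is at least 1, and the smoothing estimate for the
  datum suffices. The comparison time \<sigma> is kept apart from \<open>s\<close> for the case
  \<open>t < h\<close>.\<close>

lemma delay_mild_solution_history_bound:
  fixes \<Lambda> :: "real \<Rightarrow> real"
  assumes u0: "\<And>s. s \<in> {-h..0} \<Longrightarrow> integrable lborel (u0 s)" "\<And>s. s \<in> {-h..0} \<Longrightarrow> L1_norm (u0 s) \<le> C"
    and sol: "delay_mild_solution h m p q d u0 u"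
    and s: "s \<in> {-h..0}" and \<rho>: "\<rho> > 0" and \<Lambda>: "\<And>\<xi>. \<Lambda> \<xi> \<le> 0" and \<sigma>: "\<sigma> \<le> 0"
  shows "ennreal \<bar>drift_semigroup m p \<rho> (u s) x\<bar>
    \<le> ennreal (C / (2 * pi)) * (\<integral>\<^sup>+\<xi>. ennreal (exp ((p - \<xi>\<^sup>2) * \<rho> + \<Lambda> \<xi> * \<sigma>)) \<partial>lborel)"
proof -
  have "integrable lborel (u s)"
    using sol s by (auto simp: delay_mild_solution_def L1_continuous_on_def)
  then have "drift_semigroup m p \<rho> (u s) x = drift_semigroup m p \<rho> (u0 s) x"
    using sol s u0(1)[OF s] by (intro drift_semigroup_cong_AE) (auto simp: delay_mild_solution_def)
  then have "ennreal \<bar>drift_semigroup m p \<rho> (u s) x\<bar>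
      \<le> ennreal (C / (2 * pi)) * (\<integral>\<^sup>+\<xi>. ennreal (exp ((p - \<xi>\<^sup>2) * \<rho>)) \<partial>lborel)"
    using drift_semigroup_le_nn_integral[OF \<rho> u0(1)[OF s] u0(2)[OF s]] by simp
  also have "\<dots> \<le> ennreal (C / (2 * pi)) * (\<integral>\<^sup>+\<xi>. ennreal (exp ((p - \<xi>\<^sup>2) * \<rho> + \<Lambda> \<xi> * \<sigma>)) \<partial>lborel)"
    using \<Lambda> \<sigma> by (intro mult_left_mono nn_integral_mono ennreal_leI) (auto simp: mult_nonpos_nonpos)
  finally show ?thesis .
qed

text \<open>Method of steps with comparison delay \<open>h\<close>: induction on \<open>n\<close>
  for times up to \<open>n * h\<close>. If \<open>s' \<le> s \<le> (n + 1) * h\<close>, then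
  \<open>s' - h \<le> n * h\<close>, so the induction hypothesis covers the history. The bound
  concerns all positive smoothing times and all points, as the next step needs.\<close>

lemma delay_mild_solution_bound:
  fixes \<Lambda> :: "real \<Rightarrow> real"
  assumes h: "h > 0" and q: "q \<ge> 0"
    and u0: "\<And>s. s \<in> {-h..0} \<Longrightarrow> integrable lborel (u0 s)" "\<And>s. s \<in> {-h..0} \<Longrightarrow> L1_norm (u0 s) \<le> C"
    and sol: "delay_mild_solution h m p q d u0 u"
    and \<Lambda>: "\<Lambda> \<in> borel_measurable borel" "\<And>\<xi>. q * exp (- h * \<Lambda> \<xi>) \<le> \<Lambda> \<xi> + \<xi>\<^sup>2 - p" "\<And>\<xi>. \<Lambda> \<xi> \<le> 0"
    and s: "- h \<le> s" and \<rho>: "\<rho> > 0"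
  shows "ennreal \<bar>drift_semigroup m p \<rho> (u s) x\<bar>
    \<le> ennreal (C / (2 * pi)) * (\<integral>\<^sup>+\<xi>. ennreal (exp ((p - \<xi>\<^sup>2) * \<rho> + \<Lambda> \<xi> * s)) \<partial>lborel)"
proof -
  have u: "L1_continuous_on {-h..} u"
    and mild: "\<And>t. t > 0 \<Longrightarrow> AE x in lborel. u t x = mild_rhs h m p q d (u0 0) u t x"
    using sol by (auto simp: delay_mild_solution_def mild_rhs_def duhamel_def)
  have u00: "integrable lborel (u0 0)" "L1_norm (u0 0) \<le> C"
    using u0[of 0] h by auto
  have "ennreal \<bar>drift_semigroup m p \<rho> (u s) x\<bar>
    \<le> ennreal (C / (2 * pi)) * (\<integral>\<^sup>+\<xi>. ennreal (exp ((p - \<xi>\<^sup>2) * \<rho> + \<Lambda> \<xi> * s)) \<partial>lborel)"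
    if "- h \<le> s" "s \<le> real n * h" "\<rho> > 0" for n s \<rho> x
    using that
  proof (induction n arbitrary: s \<rho> x)
    case 0
    then show ?case
      by (intro delay_mild_solution_history_bound[OF u0 sol] \<Lambda>) auto
  next
    case (Suc n)
    show ?case
    proof (cases "s \<le> 0")
      case True
      then show ?thesis
        using Suc.prems by (intro delay_mild_solution_history_bound[OF u0 sol] \<Lambda>) auto
    next
      case False
      then have s: "s > 0" by simp
      have "integrable lborel (u s)"
        using u Suc.prems(1) by (auto simp: L1_continuous_on_def)
      then have "u s \<in> borel_measurable borel" by simp
      moreover have "mild_rhs h m p q d (u0 0) u s \<in> borel_measurable borel"
        by (intro borel_measurable_continuous_onI continuous_on_mild_rhs s u00 u)
      ultimately have "drift_semigroup m p \<rho> (u s) x = drift_semigroup m p \<rho> (mild_rhs h m p q d (u0 0) u s) x"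
        by (rule drift_semigroup_cong_AE[OF mild[OF s]])
      moreover have "ennreal \<bar>if \<rho> = 0 then mild_rhs h m p q d (u0 0) u s x
            else drift_semigroup m p \<rho> (mild_rhs h m p q d (u0 0) u s) x\<bar>
          \<le> ennreal (C / (2 * pi)) * (\<integral>\<^sup>+\<xi>. ennreal (exp ((p - \<xi>\<^sup>2) * \<rho> + \<Lambda> \<xi> * s)) \<partial>lborel)"
      proof (rule mild_rhs_bound[OF s q u00 u \<Lambda>(1,2)])
        fix \<rho>' s' y :: real assume "\<rho>' > 0" "0 \<le> s'" "s' \<le> s"
        then show "ennreal \<bar>drift_semigroup m p \<rho>' (u (s' - h)) y\<bar>
            \<le> ennreal (C / (2 * pi)) * (\<integral>\<^sup>+\<xi>. ennreal (exp ((p - \<xi>\<^sup>2) * \<rho>' + \<Lambda> \<xi> * (s' - h))) \<partial>lborel)"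
          using Suc.prems(2) by (intro Suc.IH) (auto simp: algebra_simps)
      qed (use Suc.prems in simp)
      ultimately show ?thesis using Suc.prems(3) by simp
    qed
  qed
  moreover obtain n :: nat where "s / h \<le> real n"
    using real_arch_simple by blast
  ultimately show ?thesis using h s \<rho> by (simp add: pos_divide_le_eq)
qed

lemma delay_mild_solution_sup_bound:
  assumes h: "h > 0" and q: "q \<ge> 0"
    and \<gamma>: "\<gamma> - p = q * exp (- h * \<gamma>)" "\<gamma> \<le> 0"
    and u0: "\<And>s. s \<in> {-h..0} \<Longrightarrow> integrable lborel (u0 s)" "\<And>s. s \<in> {-h..0} \<Longrightarrow> L1_norm (u0 s) \<le> C"
    and sol: "delay_mild_solution h m p q d u0 u" and t: "t > 0"
  shows "\<bar>mild_rhs h m p q d (u0 0) u t x\<bar>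
    \<le> 1 / 2 * C * sqrt (1 + h * (\<gamma> - p)) * (exp (\<gamma> * t) / sqrt t)"
proof -
  define \<kappa> where "\<kappa> = 1 + h * (\<gamma> - p)"
  \<comment> \<open>Both constraints must hold: \<open>\<eta> \<le> h\<close> for the supersolution,
    \<open>\<eta> \<le> t\<close> for Bernoulli's inequality.\<close>
  define \<eta> where "\<eta> = min h t"
  define \<Lambda> where "\<Lambda> = mode_rate \<gamma> \<kappa> \<eta>"
  have \<eta>: "0 < \<eta>" "\<eta> \<le> h" "\<eta> \<le> t" using h t by (auto simp: \<eta>_def)
  have \<kappa>: "\<kappa> > 0" using h q by (simp add: \<kappa>_def \<gamma>(1) add_pos_nonneg)
  have \<Lambda>0: "\<Lambda> \<xi> \<le> 0" for \<xi>
    unfolding \<Lambda>_def by (intro mode_rate_nonpos \<gamma> \<eta> \<kappa>)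
  have super: "q * exp (- \<eta> * \<Lambda> \<xi>) \<le> \<Lambda> \<xi> + \<xi>\<^sup>2 - p" for \<xi>
    unfolding \<Lambda>_def \<kappa>_def by (intro mode_rate_supersolution \<gamma> q \<eta>)
  have [measurable]: "\<Lambda> \<in> borel_measurable borel" unfolding \<Lambda>_def by measurable
  have u: "L1_continuous_on {-h..} u"
    using sol by (simp add: delay_mild_solution_def)
  have u00: "integrable lborel (u0 0)" "L1_norm (u0 0) \<le> C"
    using u0[of 0] h by auto
  have C: "C \<ge> 0" using u00(2) L1_norm_nonneg[of "u0 0"] by linarith
  have "ennreal \<bar>if (0::real) = 0 then mild_rhs h m p q d (u0 0) u t x else drift_semigroup m p 0 (mild_rhs h m p q d (u0 0) u t) x\<bar>
    \<le> ennreal (C / (2 * pi)) * (\<integral>\<^sup>+\<xi>. ennreal (exp ((p - \<xi>\<^sup>2) * 0 + \<Lambda> \<xi> * t)) \<partial>lborel)"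
  proof (rule mild_rhs_bound[OF t q u00 u _ super])
    fix \<rho> s y :: real assume \<rho>: "\<rho> > 0" and s: "0 \<le> s" "s \<le> t"
    show "ennreal \<bar>drift_semigroup m p \<rho> (u (s - h)) y\<bar>
        \<le> ennreal (C / (2 * pi)) * (\<integral>\<^sup>+\<xi>. ennreal (exp ((p - \<xi>\<^sup>2) * \<rho> + \<Lambda> \<xi> * (s - \<eta>))) \<partial>lborel)"
    proof (cases "h \<le> t")
      case True
      then have \<eta>h: "\<eta> = h" by (simp add: \<eta>_def)
      show ?thesis
        unfolding \<eta>h
        by (rule delay_mild_solution_bound[OF h q u0 sol _ super[unfolded \<eta>h] \<Lambda>0 _ \<rho>])
           (use s in auto)
    next
      \<comment> \<open>Since \<open>s \<le> t < h\<close>, the delayed time \<open>s - h\<close>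
        lies in the initial interval, and the comparison time \<open>s - t\<close> is
        nonpositive.\<close>
      case False
      then have \<eta>t: "\<eta> = t" by (simp add: \<eta>_def)
      show ?thesis
        unfolding \<eta>t
        by (rule delay_mild_solution_history_bound[OF u0 sol _ \<rho> \<Lambda>0])
           (use False s in auto)
    qed
  qed auto
  also have "(\<integral>\<^sup>+\<xi>. ennreal (exp ((p - \<xi>\<^sup>2) * 0 + \<Lambda> \<xi> * t)) \<partial>lborel)
      \<le> (\<integral>\<^sup>+\<xi>. ennreal (exp (\<gamma> * t)) * ennreal (1 / (1 + t / \<kappa> * \<xi>\<^sup>2)) \<partial>lborel)"
  proof (rule nn_integral_mono)
    fix \<xi>
    have "exp (\<Lambda> \<xi> * t) \<le> exp (\<gamma> * t) * (1 / (1 + t / \<kappa> * \<xi>\<^sup>2))"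
      unfolding \<Lambda>_def by (intro exp_mode_rate_le \<eta> \<kappa>)
    then have "ennreal (exp (\<Lambda> \<xi> * t)) \<le> ennreal (exp (\<gamma> * t) * (1 / (1 + t / \<kappa> * \<xi>\<^sup>2)))"
      by (rule ennreal_leI)
    also have "\<dots> = ennreal (exp (\<gamma> * t)) * ennreal (1 / (1 + t / \<kappa> * \<xi>\<^sup>2))"
      using t \<kappa> by (intro ennreal_mult) auto
    finally show "ennreal (exp ((p - \<xi>\<^sup>2) * 0 + \<Lambda> \<xi> * t)) \<le> ennreal (exp (\<gamma> * t)) * ennreal (1 / (1 + t / \<kappa> * \<xi>\<^sup>2))"
      by simp
  qed
  also have "\<dots> = ennreal (exp (\<gamma> * t)) * (\<integral>\<^sup>+\<xi>. ennreal (1 / (1 + t / \<kappa> * \<xi>\<^sup>2)) \<partial>lborel)"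
    by (rule nn_integral_cmult) measurable
  also have "\<dots> = ennreal (exp (\<gamma> * t) * (pi / sqrt (t / \<kappa>)))"
    using t \<kappa> by (subst nn_integral_inverse_1_plus_square) (simp_all add: ennreal_mult[symmetric])
  finally have "ennreal \<bar>mild_rhs h m p q d (u0 0) u t x\<bar>
      \<le> ennreal (C / (2 * pi)) * ennreal (exp (\<gamma> * t) * (pi / sqrt (t / \<kappa>)))"
    by (simp add: mult_left_mono)
  also have "\<dots> = ennreal (C / (2 * pi) * (exp (\<gamma> * t) * (pi / sqrt (t / \<kappa>))))"
    using C t \<kappa> by (intro ennreal_mult[symmetric]) auto
  finally have "\<bar>mild_rhs h m p q d (u0 0) u t x\<bar> \<le> C / (2 * pi) * (exp (\<gamma> * t) * (pi / sqrt (t / \<kappa>)))"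
    using C t \<kappa> by (subst (asm) ennreal_le_iff) auto
  \<comment> \<open>The factor \<pi> of the arctangent integral cancels against
    \<open>C / (2 * pi)\<close>, leaving the constant 1/2.\<close>
  also have "\<dots> = 1 / 2 * C * sqrt \<kappa> * (exp (\<gamma> * t) / sqrt t)"
    by (simp add: real_sqrt_divide)
  finally show ?thesis unfolding \<kappa>_def .
qed

text \<open>An L1 class has no pointwise values, so the supremum is that of its continuous
  representative \<open>v\<close>, which is unique because continuous functions that agree almost
  everywhere are equal. The clause \<open>bdd_above\<close> makes the real-valued \<open>SUP\<close>
  a genuine supremum.\<close>

theorem theorem1:
  fixes h m p q d \<gamma> :: real
    and u0 u :: "real \<Rightarrow> real \<Rightarrow> real"
  assumes "h > 0"
    and "- p \<ge> q" and "q \<ge> 0"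
    and "\<gamma> = (THE g. g - p = q * exp (- h * g))"
    and "L1_continuous_on {-h..0} u0"
    and "delay_mild_solution h m p q d u0 u"
  defines "C \<equiv> (SUP s\<in>{-h..0}. L1_norm (u0 s))"
  defines "A \<equiv> 1 / 2 * C * sqrt (1 + h * (\<gamma> - p))"
  shows "(\<forall>g. g - p = q * exp (- h * g) \<longleftrightarrow> g = \<gamma>) \<and> \<gamma> \<le> 0 \<and>
    (\<forall>t>h/2. \<exists>v. continuous_on UNIV v \<and> (AE x in lborel. u t x = v x) \<and>
       bdd_above (range (\<lambda>x. \<bar>v x\<bar>)) \<and>
       (SUP x. \<bar>v x\<bar>) \<le> A * (exp (\<gamma> * t) / sqrt t))"
proof -
  note h = assms(1) and q = assms(3) and sol = assms(6)
  obtain g where g: "g - p = q * exp (- h * g)" "g \<le> 0" "\<And>g'. g' - p = q * exp (- h * g') \<Longrightarrow> g' = g"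
    using delay_root[OF assms(1-3)] by blast
  \<comment> \<open>Existence and uniqueness of the root give the definite description its intended
    value.\<close>
  have "\<gamma> = g"
    unfolding assms(4) by (rule the_equality, rule g(1), rule g(3))
  note \<gamma> = g[folded this]
  have u0: "integrable lborel (u0 s)" if "s \<in> {-h..0}" for s
    using assms(5) that by (auto simp: L1_continuous_on_def)
  have le: "L1_norm (u0 s) \<le> C" if "s \<in> {-h..0}" for s
    unfolding C_def
    using that by (intro cSUP_upper L1_continuous_on_bounded[OF assms(5)] compact_Icc)
  have "\<exists>v. continuous_on UNIV v \<and> (AE x in lborel. u t x = v x) \<and>
       bdd_above (range (\<lambda>x. \<bar>v x\<bar>)) \<and> (SUP x. \<bar>v x\<bar>) \<le> A * (exp (\<gamma> * t) / sqrt t)"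
    if "t > h / 2" for t
  proof (intro exI[of _ "mild_rhs h m p q d (u0 0) u t"] conjI)
    have t: "t > 0" using that h by linarith
    have bound: "\<bar>mild_rhs h m p q d (u0 0) u t x\<bar> \<le> A * (exp (\<gamma> * t) / sqrt t)" for x
      unfolding A_def by (rule delay_mild_solution_sup_bound[OF h q \<gamma>(1,2) u0 le sol t])
    show "continuous_on UNIV (mild_rhs h m p q d (u0 0) u t)"
      using sol h by (intro continuous_on_mild_rhs t u0) (auto simp: delay_mild_solution_def)
    show "AE x in lborel. u t x = mild_rhs h m p q d (u0 0) u t x"
      using sol t by (auto simp: delay_mild_solution_def mild_rhs_def duhamel_def)
    show "bdd_above (range (\<lambda>x. \<bar>mild_rhs h m p q d (u0 0) u t x\<bar>))"
      using bound by (intro bdd_aboveI2)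
    show "(SUP x. \<bar>mild_rhs h m p q d (u0 0) u t x\<bar>) \<le> A * (exp (\<gamma> * t) / sqrt t)"
      using bound by (intro cSUP_least) auto
  qed
  moreover have "\<forall>g. g - p = q * exp (- h * g) \<longleftrightarrow> g = \<gamma>"
    using \<gamma>(1,3) by blast
  ultimately show ?thesis using \<gamma>(2) by blast
qed

end
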